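(* Let $(X,Y,Z)$ be an orthogonal random motion in $\mathbb{R}^3$ with speed $c>0$ and rate function $\lambda\in C^1((0,\infty),(0,\infty))$, and let $T_z=\{T_z(t)\}_{t\ge0}$, where $T_z(t)$ is the time that the motion spends moving parallel to the $z$-axis (i.e. with direction $(0,0,1)$ or $(0,0,-1)$) during $[0,t]$. Then $T_z$ is an asymmetric one-dimensional random motion with velocity $V_z(t)\in\{0,1\}$ a.s., $t>0$, such that $$V_z(0)=\begin{cases}1,&\text{with probability }1/3,\\ 0,&\text{with probability }2/3.\end{cases}$$ Furthermore, the changes of velocity obey the following rule: (i) if $(X,Y,Z)$ is an orthogonal standard motion (OSM), when $V_z(t)=1$ the rate function (of switching to velocity $0$) is $\lambda_1(t)=\lambda(t)$, $t>0$, and when $V_z(t)=0$ the rate function (of switching to velocity $1$) is $\lambda_0(t)=\lambda(t)/2$, $t>0$; (ii) if $(X,Y,Z)$ is an orthogonal uniform motion (OUM), when $V_z(t)=1$ the rate function is $\lambda_1(t)=2\lambda(t)/3$, $t>0$, and when $V_z(t)=0$ the rate function is $\lambda_0(t)=\lambda(t)/3$, $t>0$.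
   Context: Motions in $\mathbb{R}^3$. Let $d_0=(1,0,0)$, $d_1=(0,1,0)$, $d_2=(0,0,1)$, $d_3=(-1,0,0)$, $d_4=(0,-1,0)$, $d_5=(0,0,-1)$. An orthogonal random motion with speed $c>0$ and rate function $\lambda:(0,\infty)\to(0,\infty)$ is the process $(X(t),Y(t),Z(t))=c\int_0^t D(s)\,ds$, where $D(s)\in\{d_0,\dots,d_5\}$ is the current direction. The initial direction $D(0)$ is uniform on the six directions, and $D$ can change only at the events of a (possibly non-homogeneous) Poisson process with rate function $\lambda$, independent of the choices of direction. At each event the new direction is chosen, given the current one and independently of the rest of the past, as follows. - Orthogonal standard motion (OSM): uniformly among the four directions orthogonal to the current one. - Orthogonal uniform motion (OUM): uniformly among all six directions (including the current one and its opposite). The integral $\Lambda(t)=\int_0^t\lambda(s)\,ds$ may be infinite. In that case events accumulate at time $0$, and $D$ on $(0,\infty)$ is understood as the time-inhomogeneous Markov jump process for which events occur at rate $\lambda(t)$ at time $t$, the new direction at each event being chosen uniformly among the four directions orthogonal to the current one (OSM) or uniformly among all six directions (OUM), and for which $D(t)$ is uniform on the six directions for every $t>0$ (a property that also holds when $\Lambda(t)<\infty$). A one-dimensional random motion with velocities $1$ and $0$ and rate functions $\lambda_1,\lambda_0$ is a process $T(t)=\int_0^t V(s)\,ds$, where $V$ is a time-inhomogeneous Markov jump process on $\{0,1\}$ that at time $t$ switches from $1$ to $0$ at rate $\lambda_1(t)$ and from $0$ to $1$ at rate $\lambda_0(t)$. *)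

theory Defs
  imports "HOL-Probability.Probability"
begin

section \<open>Markov jump processes with time-dependent rates\<close>

text \<open>
  The state set is finite, \<open>I\<close> is the set of times (\<open>{0..}\<close> or \<open>{0<..}\<close>), and \<open>q t i j\<close> is the
  rate at time \<open>t\<close> of jumping from \<open>i\<close> to \<open>j \<noteq> i\<close>.
\<close>

text \<open>
  Right-continuous step functions with left limits, for the discrete topology on the values; by
  compactness these are the paths with finitely many jumps in each \<open>{a..b} \<subseteq> I\<close>.
\<close>
definition jump_path :: "real set \<Rightarrow> (real \<Rightarrow> 'a) \<Rightarrow> bool" where
  "jump_path I x \<longleftrightarrow>
     (\<forall>t\<in>I. (\<forall>\<^sub>F s in at_right t. x s = x t) \<and>
            (\<exists>y. \<forall>\<^sub>F s in at t within (I \<inter> {..<t}). x s = y))"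

text \<open>
  \<open>P s t i j\<close> is the probability of being in \<open>j\<close> at time \<open>t\<close> when in \<open>i\<close> at time \<open>s\<close>. The last
  clause is Kolmogorov's forward equation; the diagonal terms \<open>q t j j\<close> cancel in it, so the
  diagonal of \<open>q\<close> is irrelevant. It is only required for \<open>t > s\<close> because the rates need not be
  defined or bounded at time 0.
\<close>
definition transition_probs ::
  "real set \<Rightarrow> 'a set \<Rightarrow> (real \<Rightarrow> 'a \<Rightarrow> 'a \<Rightarrow> real) \<Rightarrow> (real \<Rightarrow> real \<Rightarrow> 'a \<Rightarrow> 'a \<Rightarrow> real) \<Rightarrow> bool" where
  "transition_probs I S q P \<longleftrightarrow>
     (\<forall>s\<in>I. \<forall>i\<in>S.
        (\<forall>t\<ge>s. (\<forall>j\<in>S. P s t i j \<ge> 0) \<and> (\<Sum>j\<in>S. P s t i j) = 1) \<and>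
        (\<forall>j\<in>S. P s s i j = (if i = j then 1 else 0) \<and>
               continuous_on {s..} (\<lambda>t. P s t i j) \<and>
               (\<forall>t>s. ((\<lambda>t. P s t i j) has_real_derivative
                  (\<Sum>k\<in>S. P s t i k * q t k j - P s t i j * q t j k)) (at t))))"

definition generated_sigma :: "'w measure \<Rightarrow> 'i set \<Rightarrow> ('i \<Rightarrow> 'w \<Rightarrow> 'a) \<Rightarrow> 'w set set" where
  "generated_sigma M I X = sigma_sets (space M) {X u -` B \<inter> space M | u B. u \<in> I}"

definition markov_jump_process ::
  "'w measure \<Rightarrow> real set \<Rightarrow> 'a set \<Rightarrow> (real \<Rightarrow> 'a \<Rightarrow> 'a \<Rightarrow> real) \<Rightarrow> (real \<Rightarrow> 'w \<Rightarrow> 'a) \<Rightarrow> bool" where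
  "markov_jump_process M I S q X \<longleftrightarrow>
     prob_space M \<and> finite S \<and>
     (\<forall>t\<in>I. X t \<in> M \<rightarrow>\<^sub>M count_space S) \<and>
     (AE \<omega> in M. jump_path I (\<lambda>t. X t \<omega>)) \<and>
     (\<exists>P. transition_probs I S q P \<and>
        (\<forall>s\<in>I. \<forall>t\<in>I. s \<le> t \<longrightarrow> (\<forall>A\<in>generated_sigma M {u \<in> I. u \<le> s} X. \<forall>i\<in>S. \<forall>j\<in>S.
           \<P>(\<omega> in M. \<omega> \<in> A \<and> X s \<omega> = i \<and> X t \<omega> = j) =
           \<P>(\<omega> in M. \<omega> \<in> A \<and> X s \<omega> = i) * P s t i j)))"

section \<open>Poisson processes\<close>

definition cumulative_rate :: "(real \<Rightarrow> real) \<Rightarrow> real \<Rightarrow> ennreal" where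
  "cumulative_rate l t = (\<integral>\<^sup>+s\<in>{0<..t}. ennreal (l s) \<partial>lborel)"

text \<open>For positive continuous \<open>l\<close>, the cumulative rate is finite at all \<open>t > 0\<close> or at none.\<close>
definition finite_rate :: "(real \<Rightarrow> real) \<Rightarrow> bool" where
  "finite_rate l \<longleftrightarrow> (\<forall>t>0. cumulative_rate l t < \<infinity>)"

text \<open>
  The counting process of a Poisson process on \<open>{0<..}\<close> with rate function \<open>l\<close>, for
  \<open>finite_rate l\<close>. The truncated differences \<open>N t \<omega> - N s \<omega>\<close> are true differences almost surely,
  by monotonicity.
\<close>
definition poisson_process :: "'w measure \<Rightarrow> (real \<Rightarrow> real) \<Rightarrow> (real \<Rightarrow> 'w \<Rightarrow> nat) \<Rightarrow> bool" where
  "poisson_process M l N \<longleftrightarrow>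
     prob_space M \<and>
     (\<forall>t\<ge>0. N t \<in> M \<rightarrow>\<^sub>M count_space UNIV) \<and>
     (AE \<omega> in M. N 0 \<omega> = 0 \<and> mono_on {0..} (\<lambda>t. N t \<omega>) \<and>
        (\<forall>t\<ge>0. \<forall>\<^sub>F s in at_right t. N s \<omega> = N t \<omega>)) \<and>
     (\<forall>n. \<forall>t :: nat \<Rightarrow> real. mono t \<and> 0 \<le> t 0 \<longrightarrow>
        prob_space.indep_vars M (\<lambda>_. count_space UNIV)
          (\<lambda>i \<omega>. N (t (Suc i)) \<omega> - N (t i) \<omega>) {..<n}) \<and>
     (\<forall>s t. 0 \<le> s \<and> s < t \<longrightarrow>
        distr M (count_space UNIV) (\<lambda>\<omega>. N t \<omega> - N s \<omega>) =
        measure_pmf (poisson_pmf (LBINT u:{s<..t}. l u)))"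

section \<open>Orthogonal random motions\<close>

definition z_directions :: "(real ^ 3) set" where
  "z_directions = {vector [0, 0, 1], vector [0, 0, -1]}"

definition directions :: "(real ^ 3) set" where
  "directions = {vector [1, 0, 0], vector [0, 1, 0], vector [-1, 0, 0], vector [0, -1, 0]}
     \<union> z_directions"

datatype motion_kind = OSM | OUM

fun next_direction :: "motion_kind \<Rightarrow> real ^ 3 \<Rightarrow> (real ^ 3) pmf" where
  "next_direction OSM d = pmf_of_set {e \<in> directions. orthogonal e d}"
| "next_direction OUM d = pmf_of_set directions"

definition uniform_direction :: "'w measure \<Rightarrow> ('w \<Rightarrow> real ^ 3) \<Rightarrow> bool" where
  "uniform_direction M X \<longleftrightarrow>
     X \<in> M \<rightarrow>\<^sub>M count_space directions \<and>
     distr M (count_space directions) X = uniform_count_measure directions"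

text \<open>
  The successive choices of direction; \<open>\<xi> 0\<close> is the initial direction and \<open>\<xi> (Suc n)\<close> the one
  chosen at the event number \<open>Suc n\<close>.
\<close>
definition direction_chain ::
  "'w measure \<Rightarrow> motion_kind \<Rightarrow> (nat \<Rightarrow> 'w \<Rightarrow> real ^ 3) \<Rightarrow> bool" where
  "direction_chain M \<kappa> \<xi> \<longleftrightarrow>
     (\<forall>n. \<xi> n \<in> M \<rightarrow>\<^sub>M count_space directions) \<and>
     uniform_direction M (\<xi> 0) \<and>
     (\<forall>n. \<forall>x :: nat \<Rightarrow> real ^ 3. range x \<subseteq> directions \<longrightarrow>
        \<P>(\<omega> in M. \<forall>k\<le>Suc n. \<xi> k \<omega> = x k) =
        \<P>(\<omega> in M. \<forall>k\<le>n. \<xi> k \<omega> = x k) * pmf (next_direction \<kappa> (x n)) (x (Suc n)))"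

text \<open>
  If the cumulative rate is infinite, events accumulate at time 0, so that \<open>D\<close> on \<open>{0<..}\<close> has no
  first event from which to construct it and is specified by its jump rates and marginal laws
  instead. For \<open>OUM\<close>, an event that keeps the direction is not a jump.
\<close>
definition direction_process ::
  "'w measure \<Rightarrow> motion_kind \<Rightarrow> (real \<Rightarrow> real) \<Rightarrow> (real \<Rightarrow> 'w \<Rightarrow> real ^ 3) \<Rightarrow> bool" where
  "direction_process M \<kappa> l D \<longleftrightarrow>
     prob_space M \<and>
     (\<forall>t\<ge>0. D t \<in> M \<rightarrow>\<^sub>M count_space directions) \<and>
     uniform_direction M (D 0) \<and>
     (if finite_rate l then
        (\<exists>N \<xi>. poisson_process M l N \<and> direction_chain M \<kappa> \<xi> \<and>
           prob_space.indep_set M (generated_sigma M UNIV \<xi>) (generated_sigma M {0..} N) \<and>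
           (AE \<omega> in M. \<forall>t\<ge>0. D t \<omega> = \<xi> (N t \<omega>) \<omega>))
      else
        markov_jump_process M {0<..} directions
          (\<lambda>t d e. l t * pmf (next_direction \<kappa> d) e) D \<and>
        (\<forall>t>0. uniform_direction M (D t)))"

text \<open>\<open>W t = (X t, Y t, Z t)\<close> is the position and \<open>D t\<close> the direction at time \<open>t\<close>.\<close>
definition orthogonal_random_motion ::
  "'w measure \<Rightarrow> motion_kind \<Rightarrow> real \<Rightarrow> (real \<Rightarrow> real) \<Rightarrow>
   (real \<Rightarrow> 'w \<Rightarrow> real ^ 3) \<Rightarrow> (real \<Rightarrow> 'w \<Rightarrow> real ^ 3) \<Rightarrow> bool" where
  "orthogonal_random_motion M \<kappa> c l D W \<longleftrightarrow>
     direction_process M \<kappa> l D \<and>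
     (AE \<omega> in M. \<forall>t\<ge>0. W t \<omega> = c *\<^sub>R integral {0..t} (\<lambda>s. D s \<omega>))"

definition time_parallel_z :: "(real \<Rightarrow> 'w \<Rightarrow> real ^ 3) \<Rightarrow> real \<Rightarrow> 'w \<Rightarrow> real" where
  "time_parallel_z D t \<omega> = measure lborel {s \<in> {0..t}. D s \<omega> \<in> z_directions}"

definition velocity_z :: "(real \<Rightarrow> 'w \<Rightarrow> real ^ 3) \<Rightarrow> real \<Rightarrow> 'w \<Rightarrow> real" where
  "velocity_z D t \<omega> = indicator z_directions (D t \<omega>)"

section \<open>One-dimensional random motions with velocities 1 and 0\<close>

text \<open>
  \<open>V\<close> is the velocity and \<open>T\<close> the position; \<open>l1\<close> is the rate of switching from 1 to 0 and \<open>l0\<close>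
  the rate of switching from 0 to 1. The Markov property can start at time 0 only if switches do
  not accumulate there.
\<close>
definition one_dim_motion ::
  "'w measure \<Rightarrow> (real \<Rightarrow> 'w \<Rightarrow> real) \<Rightarrow> (real \<Rightarrow> 'w \<Rightarrow> real) \<Rightarrow>
   (real \<Rightarrow> real) \<Rightarrow> (real \<Rightarrow> real) \<Rightarrow> bool" where
  "one_dim_motion M T V l1 l0 \<longleftrightarrow>
     (\<forall>t\<ge>0. V t \<in> M \<rightarrow>\<^sub>M count_space {0, 1}) \<and>
     markov_jump_process M (if finite_rate (\<lambda>t. l1 t + l0 t) then {0..} else {0<..}) {0, 1}
       (\<lambda>t v w. if v = 1 \<and> w = 0 then l1 t else if v = 0 \<and> w = 1 then l0 t else 0) V \<and>
     (AE \<omega> in M. \<forall>t\<ge>0. ((\<lambda>s. V s \<omega>) has_integral T t \<omega>) {0..t})"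

text \<open>
  \<open>V 0\<close> takes the value \<open>v\<close> with probability \<open>p\<close>. The limit at \<open>0+\<close> follows from
  right-continuity when switches do not accumulate at time 0; when they do, it is what connects
  \<open>V 0\<close> with the process on \<open>{0<..}\<close>.
\<close>
definition initial_prob :: "'w measure \<Rightarrow> (real \<Rightarrow> 'w \<Rightarrow> real) \<Rightarrow> real \<Rightarrow> real \<Rightarrow> bool" where
  "initial_prob M V v p \<longleftrightarrow>
     \<P>(\<omega> in M. V 0 \<omega> = v) = p \<and>
     ((\<lambda>t. \<P>(\<omega> in M. V t \<omega> = v)) \<longlongrightarrow> p) (at_right 0)"

end

theory Submission
  imports Defs
begin

text \<open>
  The next direction is vertical with probability \<open>1/3 + (v - 1/3) * r\<close>, where \<open>v\<close> is 1 or 0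
  according to whether the current direction is vertical, and \<open>r = - 1/2\<close> (OSM) or \<open>r = 0\<close> (OUM).
  Hence the indicator of a vertical direction is itself Markov: it relaxes to \<open>1/3\<close> by a factor
  \<open>r\<close> at each event, so by \<open>exp (- (1 - r) * \<Lambda>)\<close> over a time interval of cumulative rate \<open>\<Lambda>\<close>,
  which is the kernel of the two-state process with rates \<open>2/3 * (1 - r) * l\<close> and
  \<open>1/3 * (1 - r) * l\<close>. If the cumulative rate is finite, the factor is the mean of \<open>r ^ m\<close> under the
  Poisson law of the number \<open>m\<close> of events; otherwise it is obtained from Kolmogorov's forward
  equation, which becomes a scalar linear equation after summing over the vertical directions.
\<close>

section \<open>Directions and the two-state kernel\<close>

text \<open>A function of a Markov process is in general not Markov; here it is, because the chance
  of a vertical choice sees the current direction only through its velocity. The two cases of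
  \<open>direction_process\<close> need different arguments. With finite cumulative rate,
  \<open>D\<close> is not given as a Markov process: it is \<open>\<xi>\<close> read at the random
  index \<open>N t\<close>, and the Markov property has to be proved against every event of the
  velocity's past. Fixing \<open>N s = n\<close> and \<open>N t - N s = m\<close> makes the indices
  deterministic; independence of \<open>\<xi>\<close> and \<open>N\<close> and a pi-lambda argument
  do the rest. With infinite cumulative rate the Markov property is given, but with some
  \<open>P\<close> known only through the forward equation, so \<open>P\<close> has to be identified
  as far as the velocity sees it. Both cases meet in a kernel that depends on the rate only through
  \<open>H t - H s\<close>, where \<open>H\<close> is a primitive of \<open>l\<close>. Hence any
  antiderivative on the positive reals serves, even when the integral from 0 diverges.\<close>

lemma vector_3_eq_iff:
  "(vector [a, b, c] :: 'a::zero ^ 3) = vector [a', b', c'] \<longleftrightarrow> a = a' \<and> b = b' \<and> c = c'"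
  by (auto simp: vec_eq_iff forall_3)

lemma inner_vector_3:
  "inner (vector [a, b, c] :: real ^ 3) (vector [a', b', c']) = a * a' + b * b' + c * c'"
  by (simp add: inner_vec_def sum_3)

lemma z_directions_subset: "z_directions \<subseteq> directions"
  by (auto simp: directions_def)

lemma finite_directions [simp]: "finite directions" "finite z_directions"
  by (simp_all add: directions_def z_directions_def)

lemma card_directions: "card directions = 6" "card z_directions = 2"
  by (simp_all add: directions_def z_directions_def vector_3_eq_iff)

lemma directions_nonempty: "directions \<noteq> {}"
  by (simp add: directions_def)

text \<open>The probability of a vertical choice from a vertical direction minus that from a
  horizontal one: \<open>0 - 1/2\<close> for OSM, \<open>1/3 - 1/3\<close> for OUM.\<close>

fun switch_eigenvalue :: "motion_kind \<Rightarrow> real" where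
  "switch_eigenvalue OSM = - 1 / 2"
| "switch_eigenvalue OUM = 0"

lemma orthogonal_directions:
  assumes "d \<in> directions"
  shows "card {e \<in> directions. orthogonal e d} = 4"
    and "card {e \<in> z_directions. orthogonal e d} = (if d \<in> z_directions then 0 else 2)"
proof -
  \<comment> \<open>As sums over explicitly listed sets, the cardinalities can be evaluated by
    checking orthogonality one direction at a time.\<close>
  have *: "card {e \<in> S. P e} = (\<Sum>e\<in>S. if P e then 1 else 0)" if "finite S"
    for S :: "(real ^ 3) set" and P using that by (simp only: card_eq_sum sum.inter_filter)
  have d: "d = vector [1, 0, 0] \<or> d = vector [0, 1, 0] \<or> d = vector [- 1, 0, 0] \<or>
      d = vector [0, - 1, 0] \<or> d = vector [0, 0, 1] \<or> d = vector [0, 0, - 1]"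
    using assms by (simp add: directions_def z_directions_def) blast
  show "card {e \<in> directions. orthogonal e d} = 4"
    unfolding *[OF finite_directions(1)] unfolding directions_def z_directions_def
    using d by (elim disjE) (simp_all add: orthogonal_def inner_vector_3 vector_3_eq_iff)
  show "card {e \<in> z_directions. orthogonal e d} = (if d \<in> z_directions then 0 else 2)"
    unfolding *[OF finite_directions(2)] unfolding z_directions_def
    using d by (elim disjE) (simp_all add: orthogonal_def inner_vector_3 vector_3_eq_iff)
qed

lemma orthogonal_directions_nonempty:
  assumes "d \<in> directions"
  shows "{e \<in> directions. orthogonal e d} \<noteq> {}"
proof
  assume "{e \<in> directions. orthogonal e d} = {}"
  then have "card {e \<in> directions. orthogonal e d} = 0" by (simp only: card.empty)
  then show False
    unfolding orthogonal_directions(1)[OF assms] by linarith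
qed

lemma set_pmf_next_direction:
  assumes "d \<in> directions"
  shows "set_pmf (next_direction \<kappa> d) \<subseteq> directions"
proof (cases \<kappa>)
  case OSM
  with orthogonal_directions_nonempty[OF assms] show ?thesis by (auto simp: set_pmf_of_set)
qed (simp add: directions_nonempty)

lemma sum_pmf_next_direction:
  "d \<in> directions \<Longrightarrow> (\<Sum>e\<in>directions. pmf (next_direction \<kappa> d) e) = 1"
  by (simp add: set_pmf_next_direction sum_pmf_eq_1)

text \<open>
  The probability of choosing a vertical direction depends on \<open>d\<close> only through its being vertical,
  so the chain lumps to two states; \<open>switch_eigenvalue\<close> is the second eigenvalue of the
  lumped matrix, whose stationary law is \<open>(1/3, 2/3)\<close>.
\<close>
lemma sum_pmf_next_direction_z:
  assumes d: "d \<in> directions"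
  shows "(\<Sum>e\<in>z_directions. pmf (next_direction \<kappa> d) e) =
    1/3 + (indicator z_directions d - 1/3) * switch_eigenvalue \<kappa>"
proof (cases \<kappa>)
  case OSM
  let ?S = "{e \<in> directions. orthogonal e d}"
  have "finite ?S" "?S \<noteq> {}"
    using orthogonal_directions_nonempty[OF d] by simp_all
  then have "pmf (next_direction OSM d) e = indicator ?S e / 4" for e
    using orthogonal_directions(1)[OF assms] by (simp add: pmf_of_set)
  then have "(\<Sum>e\<in>z_directions. pmf (next_direction OSM d) e) = (\<Sum>e\<in>z_directions. indicator ?S e) / 4"
    by (simp only: sum_divide_distrib)
  also have "(\<Sum>e\<in>z_directions. indicator ?S e) = (\<Sum>e\<in>z_directions. if orthogonal e d then 1 else (0::real))"
    by (rule sum.cong) (use z_directions_subset in \<open>auto simp: indicator_def\<close>)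
  also have "\<dots> = (\<Sum>e | e \<in> z_directions \<and> orthogonal e d. 1)"
    by (simp only: sum.inter_filter finite_directions)
  also have "\<dots> = real (card {e \<in> z_directions. orthogonal e d})"
    by (rule real_of_card[symmetric])
  finally show ?thesis
    using OSM orthogonal_directions(2)[OF d] by (auto simp: indicator_def)
next
  case OUM
  have "pmf (next_direction OUM d) e = 1 / 6" if "e \<in> z_directions" for e
    using that z_directions_subset by (auto simp: pmf_of_set directions_nonempty card_directions)
  then have "(\<Sum>e\<in>z_directions. pmf (next_direction OUM d) e) = (\<Sum>e\<in>z_directions. 1 / 6)"
    by (rule sum.cong[OF refl])
  then show ?thesis
    using OUM by (simp add: card_directions)
qed

lemma switch_eigenvalue_less_1: "switch_eigenvalue \<kappa> < 1"
  by (cases \<kappa>) auto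

text \<open>On states 0 and 1 this is the matrix \<open>(1 - \<rho>) * \<Pi> + \<rho> * 1\<close>,
  where both rows of \<open>\<Pi>\<close> are the stationary law. With \<open>\<rho> = r ^ m\<close>
  it describes \<open>m\<close> choices, with an exponential a time interval; being affine in
  \<open>\<rho>\<close>, it can be averaged over \<open>m\<close>.\<close>

definition two_state_kernel :: "real \<Rightarrow> real \<Rightarrow> real \<Rightarrow> real" where
  "two_state_kernel \<rho> i j =
    (if j = 1 then 1/3 + (i - 1/3) * \<rho> else 2/3 - (i - 1/3) * \<rho>)"

lemma two_state_kernel_bounds:
  assumes "0 \<le> \<rho>" "\<rho> \<le> 1" "i \<in> {0, 1}"
  shows "0 \<le> two_state_kernel \<rho> i j"
  using assms by (auto simp: two_state_kernel_def)

text \<open>The probability \<open>p\<close> of state 1 has derivative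
  \<open>- b * l t * (p - 1/3)\<close>, which is the gain \<open>(1 - p) * b / 3 * l t\<close> minus
  the loss \<open>p * 2 * b / 3 * l t\<close>. The conditions on \<open>I\<close> fit both
  \<open>{0..}\<close> and \<open>{0<..}\<close>; upward closure is there because the forward
  equation runs over all later times. Monotonicity of \<open>H\<close> keeps the exponential at most
  1, hence the entries nonnegative.\<close>

lemma two_state_transition_probs:
  fixes H l :: "real \<Rightarrow> real"
  assumes I: "I \<subseteq> {0..}" "\<And>s t. s \<in> I \<Longrightarrow> s \<le> t \<Longrightarrow> t \<in> I"
    and H: "continuous_on I H" "mono_on I H"
    and H': "\<And>t. t > 0 \<Longrightarrow> (H has_real_derivative l t) (at t)"
    and b: "0 \<le> b"
  shows "transition_probs I {0, 1}
    (\<lambda>t v w. if v = 1 \<and> w = 0 then 2 * b / 3 * l t else if v = 0 \<and> w = 1 then b / 3 * l t else 0)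
    (\<lambda>s t. two_state_kernel (exp (- b * (H t - H s))))"
  unfolding transition_probs_def
proof (intro ballI conjI allI impI)
  fix s i j :: real assume s: "s \<in> I" and i: "i \<in> {0, 1}" and j: "j \<in> {0, 1}"
  show "two_state_kernel (exp (- b * (H s - H s))) i j = (if i = j then 1 else 0)"
    using i j by (auto simp: two_state_kernel_def)
  have "continuous_on {s..} H"
    using H(1) by (rule continuous_on_subset) (use I(2) s in auto)
  then show "continuous_on {s..} (\<lambda>t. two_state_kernel (exp (- b * (H t - H s))) i j)"
    unfolding two_state_kernel_def by (cases "j = 1") (auto intro!: continuous_intros)
next
  fix s i t :: real assume s: "s \<in> I" and i: "i \<in> {0, 1}" and t: "s \<le> t"
  have "H s \<le> H t"
    using H(2) s I(2)[OF s t] t by (auto simp: mono_on_def)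
  then have \<rho>: "exp (- b * (H t - H s)) \<le> 1"
    using b by (simp add: mult_nonneg_nonneg)
  show "0 \<le> two_state_kernel (exp (- b * (H t - H s))) i j" for j
    by (rule two_state_kernel_bounds) (use i \<rho> in auto)
  show "(\<Sum>j\<in>{0, 1}. two_state_kernel (exp (- b * (H t - H s))) i j) = 1"
    by (simp add: two_state_kernel_def)
next
  fix s i j t :: real assume s: "s \<in> I" and i: "i \<in> {0, 1}" and j: "j \<in> {0, 1}" and t: "s < t"
  have "t > 0" using s I(1) t by auto
  then have D: "(H has_real_derivative l t) (at t)" by (rule H')
  show "((\<lambda>t. two_state_kernel (exp (- b * (H t - H s))) i j) has_real_derivative
      (\<Sum>k\<in>{0, 1}. two_state_kernel (exp (- b * (H t - H s))) i k *
        (if k = 1 \<and> j = 0 then 2 * b / 3 * l t else if k = 0 \<and> j = 1 then b / 3 * l t else 0) -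
        two_state_kernel (exp (- b * (H t - H s))) i j *
        (if j = 1 \<and> k = 0 then 2 * b / 3 * l t else if j = 0 \<and> k = 1 then b / 3 * l t else 0))) (at t)"
    using j unfolding two_state_kernel_def
    by (auto intro!: derivative_eq_intros D simp: field_simps)
qed

text \<open>Integrating factor: \<open>(p t - a) * exp (b * H t)\<close> has derivative zero after
  \<open>s\<close>, and continuity at \<open>s\<close> fixes its value.\<close>

lemma linear_relaxation_unique:
  fixes p H l :: "real \<Rightarrow> real"
  assumes c: "continuous_on {s..} p" "continuous_on {s..} H"
    and p': "\<And>t. t > s \<Longrightarrow> (p has_real_derivative - b * l t * (p t - a)) (at t)"
    and H': "\<And>t. t > s \<Longrightarrow> (H has_real_derivative l t) (at t)"
    and t: "s \<le> t"
  shows "p t = a + (p s - a) * exp (- b * (H t - H s))"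
proof (cases "s = t")
  case False
  define \<phi> where "\<phi> t = (p t - a) * exp (b * H t)" for t
  have "\<phi> t = \<phi> s"
  proof (rule DERIV_isconst2[of s t])
    show "continuous_on {s..t} \<phi>"
      unfolding \<phi>_def using c by (auto intro!: continuous_intros elim: continuous_on_subset)
    show "(\<phi> has_real_derivative 0) (at x)" if "s < x" for x
      unfolding \<phi>_def
      by (auto intro!: derivative_eq_intros p'[OF that] H'[OF that] simp: algebra_simps)
  qed (use t False in auto)
  then have "(p t - a) * exp (b * H t) = (p s - a) * exp (b * H s)"
    by (simp add: \<phi>_def)
  then have "p t - a = (p s - a) * (exp (b * H s) / exp (b * H t))"
    by (simp add: field_simps)
  then show ?thesis
    by (simp add: exp_diff[symmetric] algebra_simps)
qed simp

section \<open>Occupation times\<close>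

text \<open>Sampling \<open>v\<close> at the next grid point to the right gives Borel functions,
  since they depend on \<open>t\<close> through an integer only; by right-constancy they converge to
  \<open>v\<close> at every positive time.\<close>

lemma right_continuous_step_sets_borel:
  fixes v :: "real \<Rightarrow> real"
  assumes "\<And>t. t > 0 \<Longrightarrow> \<forall>\<^sub>F s in at_right t. v s = v t"
  shows "{t \<in> {0<..}. v t = 1} \<in> sets borel"
proof -
  \<comment> \<open>Floor plus 1, not ceiling: the sampling point must lie strictly to the right of
    \<open>t\<close> to converge in \<open>at_right t\<close>.\<close>
  define u where "u n t = v ((real_of_int \<lfloor>real (Suc n) * t\<rfloor> + 1) / real (Suc n))" for n t
  have "u n \<in> borel_measurable borel" for n
  proof -
    have "(\<lambda>t. \<lfloor>real (Suc n) * t\<rfloor>) \<in> borel \<rightarrow>\<^sub>M count_space UNIV"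
      by measurable
    then show ?thesis
      unfolding u_def
      by (rule measurable_compose[where g = "\<lambda>k. v ((real_of_int k + 1) / real (Suc n))"]) simp
  qed
  then have m: "(\<lambda>t. u n t * indicator {0<..} t) \<in> borel_measurable borel" for n
    by (intro borel_measurable_times borel_measurable_indicator) auto
  have lim: "(\<lambda>n. u n t * indicator {0<..} t) \<longlonglongrightarrow> v t * indicator {0<..} t" for t
  proof (cases "t > 0")
    case True
    let ?a = "\<lambda>n. (real_of_int \<lfloor>real (Suc n) * t\<rfloor> + 1) / real (Suc n)"
    have gt: "?a n > t" for n
    proof -
      have "t * real (Suc n) < real_of_int \<lfloor>real (Suc n) * t\<rfloor> + 1"
        by (subst mult.commute) linarith
      then show ?thesis by (subst pos_less_divide_eq) auto
    qed
    have le: "?a n \<le> t + 1 / real (Suc n)" for n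
    proof -
      have "?a n \<le> (real (Suc n) * t + 1) / real (Suc n)"
        by (intro divide_right_mono add_mono) auto
      then show ?thesis by (simp add: add_divide_distrib)
    qed
    have "?a \<longlonglongrightarrow> t"
    proof (rule tendsto_sandwich[of "\<lambda>_. t"])
      show "(\<lambda>n. t + 1 / real (Suc n)) \<longlonglongrightarrow> t"
        using tendsto_add[OF tendsto_const LIMSEQ_inverse_real_of_nat, of t]
        by (simp add: inverse_eq_divide)
    qed (use gt le in \<open>auto intro!: always_eventually less_imp_le\<close>)
    then have "filterlim ?a (at_right t) sequentially"
      unfolding filterlim_at using gt by (auto simp del: of_nat_Suc simp: less_imp_neq[OF gt, symmetric])
    then have "\<forall>\<^sub>F n in sequentially. v (?a n) = v t"
      using assms[OF True] by (auto simp: filterlim_iff)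
    then have "(\<lambda>n. u n t) \<longlonglongrightarrow> v t"
      unfolding u_def by (rule tendsto_eventually)
    then show ?thesis by (intro tendsto_mult tendsto_const)
  qed simp
  have "(\<lambda>t. v t * indicator {0<..} t) \<in> borel_measurable borel"
    by (rule borel_measurable_LIMSEQ_real[OF lim m])
  then have "{t. v t * indicator {0<..} t = 1} \<in> sets borel"
    by measurable
  also have "{t. v t * indicator {0<..} t = 1} = {t \<in> {0<..}. v t = 1}"
    by (auto simp: indicator_def)
  finally show ?thesis .
qed

text \<open>The bridge from \<open>time_parallel_z\<close>, a Lebesgue measure, to the
  \<open>has_integral\<close> of \<open>one_dim_motion\<close>. The point is that the set of
  occupied times is Borel.\<close>

lemma has_integral_occupation_time:
  fixes d :: "real \<Rightarrow> 'a"
  assumes "\<And>t. t > 0 \<Longrightarrow> \<forall>\<^sub>F s in at_right t. (indicator Z (d s) :: real) = indicator Z (d t)"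
    and "t \<ge> 0"
  shows "((\<lambda>s. indicator Z (d s)) has_integral measure lborel {s \<in> {0..t}. d s \<in> Z}) {0..t}"
proof -
  let ?A = "{s \<in> {0..t}. d s \<in> Z}"
  have "{s \<in> {0<..}. indicator Z (d s) = (1::real)} \<in> sets borel"
    by (rule right_continuous_step_sets_borel) (rule assms)
  \<comment> \<open>Time 0 is added by hand, because right-constancy is assumed at positive times
    only.\<close>
  then have "{s \<in> {0<..}. indicator Z (d s) = (1::real)} \<inter> {..t} \<union> (if d 0 \<in> Z then {0} else {}) \<in> sets borel"
    by auto
  also have "{s \<in> {0<..}. indicator Z (d s) = (1::real)} \<inter> {..t} \<union> (if d 0 \<in> Z then {0} else {}) = ?A"
    using \<open>t \<ge> 0\<close> by (auto simp: indicator_def less_le)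
  finally have A: "?A \<in> sets borel" .
  have "emeasure lborel ?A \<le> emeasure lborel {0..t}"
    by (rule emeasure_mono) auto
  also have "\<dots> < \<infinity>" using \<open>t \<ge> 0\<close> by simp
  finally have "((\<lambda>s. 1) has_integral measure lborel ?A) ?A"
    using A by (intro has_integral_measure_lborel) auto
  then have "((\<lambda>s. if s \<in> ?A then 1 else 0) has_integral measure lborel ?A) {0..t}"
    by (subst has_integral_restrict) auto
  then show ?thesis
    by (rule has_integral_eq[rotated]) (auto simp: indicator_def)
qed

text \<open>\<open>one_dim_motion\<close> selects its time set by the total rate
  \<open>l1 + l0 = b * l\<close>, \<open>direction_process\<close> selects its case by
  \<open>l\<close>; the two tests have to agree.\<close>

lemma finite_rate_cmult:
  assumes l: "continuous_on {0<..} l" and "0 < b"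
  shows "finite_rate (\<lambda>t. b * l t) \<longleftrightarrow> finite_rate l"
proof -
  have "cumulative_rate (\<lambda>t. b * l t) t = ennreal b * cumulative_rate l t" for t
  proof -
    have "set_borel_measurable borel {0<..} l"
      unfolding set_borel_measurable_def using l by (intro borel_measurable_continuous_on_indicator) auto
    then have "set_borel_measurable borel {0<..t} l"
      by (rule set_borel_measurable_subset) auto
    then have m: "(\<lambda>s. ennreal (indicator {0<..t} s * l s)) \<in> borel_measurable lborel"
      by (simp add: set_borel_measurable_def)
    have *: "(\<lambda>s. ennreal (f s) * indicator {0<..t} s) = (\<lambda>s. ennreal (indicator {0<..t} s * f s))" for f
      by (auto simp: indicator_def)
    have "ennreal (indicator {0<..t} s * (b * l s)) = ennreal b * ennreal (indicator {0<..t} s * l s)" for s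
      using \<open>0 < b\<close> by (simp add: ennreal_mult'[symmetric] ac_simps)
    then show ?thesis
      unfolding cumulative_rate_def * by (simp add: nn_integral_cmult[OF m])
  qed
  moreover have "ennreal b * x < \<infinity> \<longleftrightarrow> x < \<infinity>" for x
    using \<open>0 < b\<close> by (auto simp: ennreal_mult_less_top)
  ultimately show ?thesis
    by (simp add: finite_rate_def)
qed

lemma mono_on_primitive:
  fixes H l :: "real \<Rightarrow> real"
  assumes I: "I \<subseteq> {0..}" "\<And>s t. s \<in> I \<Longrightarrow> s \<le> t \<Longrightarrow> t \<in> I"
    and H: "continuous_on I H"
    and H': "\<And>t. t > 0 \<Longrightarrow> (H has_real_derivative l t) (at t)"
    and l: "\<And>t. t > 0 \<Longrightarrow> 0 \<le> l t"
  shows "mono_on I H"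
proof (rule mono_onI)
  fix s t assume st: "s \<in> I" "t \<in> I" "s \<le> t"
  show "H s \<le> H t"
  proof (rule DERIV_nonneg_imp_increasing_open[OF st(3)])
    fix x assume "s < x"
    then have "x > 0" using I(1) st by auto
    then show "\<exists>y. (H has_real_derivative y) (at x) \<and> 0 \<le> y"
      using H' l by blast
  next
    show "continuous_on {s..t} H"
      using H by (rule continuous_on_subset) (use I(2) st in auto)
  qed
qed

section \<open>From the Markov property of the velocity to a one-dimensional motion\<close>

lemma velocity_z_measurable:
  assumes "D t \<in> M \<rightarrow>\<^sub>M count_space directions"
  shows "velocity_z D t \<in> M \<rightarrow>\<^sub>M count_space {0, 1}"
  unfolding velocity_z_def
  by (rule measurable_compose[OF assms]) (auto simp: indicator_def)

text \<open>Common end of both cases. Only increments of \<open>H\<close> enter, so \<open>H\<close>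
  may be any primitive; it has to be continuous at 0 exactly when 0 belongs to the time set.\<close>

lemma velocity_z_one_dim_motion:
  fixes b :: real and H :: "real \<Rightarrow> real"
  assumes M: "prob_space M"
    and D: "\<And>t. t \<ge> 0 \<Longrightarrow> D t \<in> M \<rightarrow>\<^sub>M count_space directions"
    and l: "\<And>t. t > 0 \<Longrightarrow> l t > 0" "continuous_on {0<..} l"
    and I: "I = (if finite_rate l then {0..} else {0<..})"
    and path: "AE \<omega> in M. jump_path I (\<lambda>t. velocity_z D t \<omega>)"
    and H: "continuous_on I H" "\<And>t. t > 0 \<Longrightarrow> (H has_real_derivative l t) (at t)"
    and b: "0 < b"
    and markov: "\<And>s t A i j. s \<in> I \<Longrightarrow> t \<in> I \<Longrightarrow> s \<le> t \<Longrightarrow>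
      A \<in> generated_sigma M {u \<in> I. u \<le> s} (velocity_z D) \<Longrightarrow> i \<in> {0, 1} \<Longrightarrow> j \<in> {0, 1} \<Longrightarrow>
      \<P>(\<omega> in M. \<omega> \<in> A \<and> velocity_z D s \<omega> = i \<and> velocity_z D t \<omega> = j) =
      \<P>(\<omega> in M. \<omega> \<in> A \<and> velocity_z D s \<omega> = i) * two_state_kernel (exp (- b * (H t - H s))) i j"
  shows "one_dim_motion M (time_parallel_z D) (velocity_z D) (\<lambda>t. 2 * b / 3 * l t) (\<lambda>t. b / 3 * l t)"
proof -
  have I': "I \<subseteq> {0..}" "{0<..} \<subseteq> I" "\<And>s t. s \<in> I \<Longrightarrow> s \<le> t \<Longrightarrow> t \<in> I"
    by (auto simp: I split: if_splits)
  have "mono_on I H"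
    by (rule mono_on_primitive[OF I'(1,3) H]) (use l in \<open>auto intro: less_imp_le\<close>)
  note tp = two_state_transition_probs[OF I'(1,3) H(1) this H(2) less_imp_le[OF b]]
  have rates: "(\<lambda>t. 2 * b / 3 * l t + b / 3 * l t) = (\<lambda>t. b * l t)"
    by (auto simp: field_simps)
  have V: "\<And>t. t \<ge> 0 \<Longrightarrow> velocity_z D t \<in> M \<rightarrow>\<^sub>M count_space {0, 1}"
    by (rule velocity_z_measurable[OF D])
  have "markov_jump_process M I {0, 1}
      (\<lambda>t v w. if v = 1 \<and> w = 0 then 2 * b / 3 * l t else if v = 0 \<and> w = 1 then b / 3 * l t else 0)
      (velocity_z D)"
    unfolding markov_jump_process_def
  proof (intro conjI exI[of _ "\<lambda>s t. two_state_kernel (exp (- b * (H t - H s)))"] ballI impI)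
  qed (use M V I' path tp markov in auto)
  moreover have "AE \<omega> in M. \<forall>t\<ge>0. ((\<lambda>s. velocity_z D s \<omega>) has_integral time_parallel_z D t \<omega>) {0..t}"
    using path
  proof eventually_elim
    case (elim \<omega>)
    show ?case
      unfolding time_parallel_z_def velocity_z_def
    proof (intro allI impI has_integral_occupation_time)
      fix t :: real assume "t > 0"
      then show "\<forall>\<^sub>F s in at_right t. (indicator z_directions (D s \<omega>) :: real) = indicator z_directions (D t \<omega>)"
        using elim I'(2) by (auto simp: jump_path_def velocity_z_def)
    qed
  qed
  ultimately show ?thesis
    unfolding one_dim_motion_def rates finite_rate_cmult[OF l(2) b] using V by (simp add: I)
qed

section \<open>Finite splitting and generated sigma-algebras\<close>

lemma (in finite_measure) measure_sum_values:
  assumes "finite T" "\<And>x. x \<in> T \<Longrightarrow> {\<omega> \<in> space M. Q \<omega> \<and> X \<omega> = x} \<in> sets M"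
  shows "measure M {\<omega> \<in> space M. Q \<omega> \<and> X \<omega> \<in> T} = (\<Sum>x\<in>T. measure M {\<omega> \<in> space M. Q \<omega> \<and> X \<omega> = x})"
proof -
  have "{\<omega> \<in> space M. Q \<omega> \<and> X \<omega> \<in> T} = (\<Union>x\<in>T. {\<omega> \<in> space M. Q \<omega> \<and> X \<omega> = x})" by auto
  then show ?thesis
    using assms
    by (simp only:) (rule finite_measure_finite_Union, auto simp: disjoint_family_on_def)
qed

lemma generated_sigma_sets:
  assumes "\<And>u. u \<in> I \<Longrightarrow> X u \<in> M \<rightarrow>\<^sub>M count_space S"
  shows "generated_sigma M I X \<subseteq> sets M"
  unfolding generated_sigma_def
proof (rule sets.sigma_sets_subset, safe)
  fix u and B assume u: "u \<in> I"
  \<comment> \<open>\<open>generated_sigma\<close> allows arbitrary \<open>B\<close>, whereas the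
    measurable sets of \<open>count_space S\<close> are the subsets of \<open>S\<close>.\<close>
  have "X u -` (B \<inter> S) \<inter> space M \<in> sets M"
    by (rule measurable_sets[OF assms[OF u]]) auto
  also have "X u -` (B \<inter> S) \<inter> space M = X u -` B \<inter> space M"
    using measurable_space[OF assms[OF u]] by auto
  finally show "X u -` B \<inter> space M \<in> sets M" .
qed

lemma generated_sigma_image:
  assumes "\<And>u \<omega>. u \<in> I \<Longrightarrow> Y u \<omega> = f (X u \<omega>)"
  shows "generated_sigma M I Y \<subseteq> generated_sigma M I X"
  unfolding generated_sigma_def
proof (rule sigma_sets_mono, safe)
  fix u and B assume u: "u \<in> I"
  have "Y u -` B \<inter> space M = X u -` (f -` B) \<inter> space M" using assms[OF u] by auto
  then show "Y u -` B \<inter> space M \<in> sigma_sets (space M) {X u -` B \<inter> space M |u B. u \<in> I}"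
    using u by auto
qed

section \<open>Lumping a Markov jump process of directions\<close>

lemma uniform_direction_velocity_z:
  assumes "uniform_direction M (D t)"
  shows "\<P>(\<omega> in M. velocity_z D t \<omega> = 1) = 1/3" "\<P>(\<omega> in M. velocity_z D t \<omega> = 0) = 2/3"
proof -
  have D: "D t \<in> M \<rightarrow>\<^sub>M count_space directions"
    and distr: "distr M (count_space directions) (D t) = uniform_count_measure directions"
    using assms by (auto simp: uniform_direction_def)
  have *: "measure M (D t -` S \<inter> space M) = card S / 6" if "S \<subseteq> directions" for S
  proof -
    have "measure M (D t -` S \<inter> space M) = measure (distr M (count_space directions) (D t)) S"
      using that by (simp add: measure_distr[OF D])
    also have "\<dots> = card S / 6"
      using that unfolding distr by (simp add: measure_uniform_count_measure card_directions)
    finally show ?thesis .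
  qed
  have "{\<omega> \<in> space M. velocity_z D t \<omega> = 1} = D t -` z_directions \<inter> space M"
    by (auto simp: velocity_z_def indicator_def)
  then show "\<P>(\<omega> in M. velocity_z D t \<omega> = 1) = 1/3"
    using *[OF z_directions_subset] by (simp add: card_directions)
  have "{\<omega> \<in> space M. velocity_z D t \<omega> = 0} = D t -` (directions - z_directions) \<inter> space M"
    using measurable_space[OF D] by (auto simp: velocity_z_def indicator_def)
  then show "\<P>(\<omega> in M. velocity_z D t \<omega> = 0) = 2/3"
    using *[of "directions - z_directions"] z_directions_subset
    by (simp add: card_directions card_Diff_subset)
qed

abbreviation velocity_directions :: "real \<Rightarrow> (real ^ 3) set" where
  "velocity_directions j \<equiv> {d \<in> directions. indicator z_directions d = j}"

lemma velocity_directions_eq: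
  "velocity_directions 1 = z_directions" "velocity_directions 0 = directions - z_directions"
  using z_directions_subset by (auto simp: indicator_def)

text \<open>Summing the forward equation over the vertical directions gives an equation in the
  vertical mass alone, because the probability of a vertical choice is the same for all directions
  of equal velocity. \<open>linear_relaxation_unique\<close> then determines that mass, and the
  horizontal mass is its complement.\<close>

lemma direction_transition_velocity:
  fixes H l :: "real \<Rightarrow> real"
  defines "b \<equiv> \<lambda>\<kappa>. 1 - switch_eigenvalue \<kappa>"
  assumes P: "transition_probs {0<..} directions (\<lambda>t d e. l t * pmf (next_direction \<kappa> d) e) P"
    and H: "\<And>t. t > 0 \<Longrightarrow> (H has_real_derivative l t) (at t)"
    and st: "0 < s" "s \<le> t" and d: "d \<in> directions" and j: "j \<in> {0, 1}"
  shows "(\<Sum>e\<in>velocity_directions j. P s t d e) =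
    two_state_kernel (exp (- b \<kappa> * (H t - H s))) (indicator z_directions d) j"
proof -
  define r where "r = switch_eigenvalue \<kappa>"
  have total: "(\<Sum>e\<in>directions. P s u d e) = 1" if "s \<le> u" for u
    using P st d that by (auto simp: transition_probs_def)
  have init: "P s s d e = (if d = e then 1 else 0)"
    and cont: "continuous_on {s..} (\<lambda>u. P s u d e)"
    and deriv: "\<And>u. u > s \<Longrightarrow> ((\<lambda>u. P s u d e) has_real_derivative
      (\<Sum>k\<in>directions. P s u d k * (l u * pmf (next_direction \<kappa> k) e) -
        P s u d e * (l u * pmf (next_direction \<kappa> e) k))) (at u)"
    if "e \<in> directions" for e
    using P st d that by (auto simp: transition_probs_def)
  let ?p = "\<lambda>u. \<Sum>e\<in>z_directions. P s u d e"
  have p: "?p t = 1/3 + (?p s - 1/3) * exp (- b \<kappa> * (H t - H s))"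
  proof (rule linear_relaxation_unique[where l = l])
    show "continuous_on {s..} ?p"
      using cont z_directions_subset by (intro continuous_on_sum) auto
    show "continuous_on {s..} H"
      using st by (intro DERIV_continuous_on[of _ _ l]) (auto intro!: has_field_derivative_at_within H)
    show "(H has_real_derivative l u) (at u)" if "s < u" for u
      using that st by (intro H) auto
    fix u assume u: "s < u"
    \<comment> \<open>Gain minus loss of vertical mass. Since the choice probabilities sum to 1, the
      loss is \<open>l u\<close> times the mass; choices that stay vertical are counted in both
      terms and cancel.\<close>
    have "(\<Sum>e\<in>z_directions. \<Sum>k\<in>directions. P s u d k * (l u * pmf (next_direction \<kappa> k) e) -
        P s u d e * (l u * pmf (next_direction \<kappa> e) k)) =
      (\<Sum>e\<in>z_directions. \<Sum>k\<in>directions. P s u d k * (l u * pmf (next_direction \<kappa> k) e)) -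
      (\<Sum>e\<in>z_directions. P s u d e * (l u * (\<Sum>k\<in>directions. pmf (next_direction \<kappa> e) k)))"
      by (simp only: sum_subtractf sum_distrib_left)
    also have "(\<Sum>e\<in>z_directions. P s u d e * (l u * (\<Sum>k\<in>directions. pmf (next_direction \<kappa> e) k))) =
      (\<Sum>e\<in>z_directions. P s u d e * l u)"
      using z_directions_subset by (intro sum.cong) (auto simp: sum_pmf_next_direction)
    also have "\<dots> = l u * ?p u"
      by (simp add: sum_distrib_left mult.commute)
    also have "(\<Sum>e\<in>z_directions. \<Sum>k\<in>directions. P s u d k * (l u * pmf (next_direction \<kappa> k) e)) =
      (\<Sum>k\<in>directions. P s u d k * (l u * (\<Sum>e\<in>z_directions. pmf (next_direction \<kappa> k) e)))"
      by (subst sum.swap) (simp only: sum_distrib_left)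
    \<comment> \<open>\<open>1/3 + (v - 1/3) * r = (1 - r) / 3 + r * v\<close> separates the total
      mass, which is 1, from the vertical mass.\<close>
    also have "\<dots> = (\<Sum>k\<in>directions. l u * ((1 - r) / 3) * P s u d k + l u * r * (P s u d k * indicator z_directions k))"
      by (intro sum.cong refl) (simp add: sum_pmf_next_direction_z r_def field_simps)
    also have "\<dots> = l u * ((1 - r) / 3) * (\<Sum>k\<in>directions. P s u d k) +
        l u * r * (\<Sum>k\<in>directions. P s u d k * indicator z_directions k)"
      by (simp only: sum.distrib sum_distrib_left)
    also have "(\<Sum>k\<in>directions. P s u d k * indicator z_directions k) = ?p u"
      using z_directions_subset
      by (simp add: sum.inter_restrict[symmetric] Int_absorb1 indicator_def if_distrib[of "(*) _"] cong: if_cong)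
    also have "(\<Sum>k\<in>directions. P s u d k) = 1"
      using u by (intro total) simp
    finally have eq: "(\<Sum>e\<in>z_directions. \<Sum>k\<in>directions. P s u d k * (l u * pmf (next_direction \<kappa> k) e) -
        P s u d e * (l u * pmf (next_direction \<kappa> e) k)) = - b \<kappa> * l u * (?p u - 1 / 3)"
      by (simp add: b_def r_def field_simps)
    have "(?p has_real_derivative (\<Sum>e\<in>z_directions. \<Sum>k\<in>directions.
        P s u d k * (l u * pmf (next_direction \<kappa> k) e) -
        P s u d e * (l u * pmf (next_direction \<kappa> e) k))) (at u)"
      using z_directions_subset u by (intro DERIV_sum deriv) auto
    then show "(?p has_real_derivative - b \<kappa> * l u * (?p u - 1 / 3)) (at u)"
      unfolding eq .
  qed (rule st)
  have "?p s = (\<Sum>e\<in>z_directions. if d = e then 1 else 0)"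
    using z_directions_subset by (intro sum.cong) (auto simp: init)
  then have "?p s = indicator z_directions d"
    by (simp add: indicator_def)
  note p = p[unfolded this]
  show ?thesis
  proof (cases "j = 1")
    case True
    then show ?thesis
      using p by (simp add: velocity_directions_eq two_state_kernel_def)
  next
    case False
    with j have "j = 0" by simp
    moreover have "(\<Sum>e\<in>directions - z_directions. P s t d e) = 1 - ?p t"
      using total[OF st(2)] z_directions_subset by (simp add: sum_diff)
    ultimately show ?thesis
      using p by (simp add: velocity_directions_eq two_state_kernel_def)
  qed
qed

text \<open>Lumpability: by \<open>direction_transition_velocity\<close>, the sum of
  \<open>P s t d e\<close> over the directions \<open>e\<close> with velocity \<open>j\<close> is
  the same for all \<open>d\<close> with velocity \<open>i\<close>, so it factors out of the sum
  over \<open>d\<close>.\<close>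

lemma markov_direction_velocity:
  fixes H l :: "real \<Rightarrow> real"
  defines "b \<equiv> \<lambda>\<kappa>. 1 - switch_eigenvalue \<kappa>"
  assumes D: "markov_jump_process M {0<..} directions (\<lambda>t d e. l t * pmf (next_direction \<kappa> d) e) D"
    and H: "\<And>t. t > 0 \<Longrightarrow> (H has_real_derivative l t) (at t)"
    and st: "0 < s" "s \<le> t" and A: "A \<in> generated_sigma M {u \<in> {0<..}. u \<le> s} (velocity_z D)"
    and i: "i \<in> {0, 1}" and j: "j \<in> {0, 1}"
  shows "\<P>(\<omega> in M. \<omega> \<in> A \<and> velocity_z D s \<omega> = i \<and> velocity_z D t \<omega> = j) =
    \<P>(\<omega> in M. \<omega> \<in> A \<and> velocity_z D s \<omega> = i) * two_state_kernel (exp (- b \<kappa> * (H t - H s))) i j"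
proof -
  interpret prob_space M
    using D by (simp add: markov_jump_process_def)
  have meas: "D u \<in> M \<rightarrow>\<^sub>M count_space directions" if "u > 0" for u
    using D that by (auto simp: markov_jump_process_def)
  \<comment> \<open>The past of the velocity is coarser than that of the directions, so the Markov
    property of \<open>D\<close> applies to \<open>A\<close>.\<close>
  have A': "A \<in> generated_sigma M {u \<in> {0<..}. u \<le> s} D"
    using A generated_sigma_image[of _ "velocity_z D" "indicator z_directions" D]
    by (auto simp: velocity_z_def)
  have "A \<in> sets M"
    using A' generated_sigma_sets[of "{u \<in> {0<..}. u \<le> s}" D M directions] meas by auto
  have ev: "{\<omega> \<in> space M. D u \<omega> = d} \<in> sets M" if "d \<in> directions" "u > 0" for d u
    using measurable_sets[OF meas[OF that(2)], of "{d}"] that(1)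
    by (simp add: vimage_def Int_def conj_commute)
  obtain P where P: "transition_probs {0<..} directions (\<lambda>t d e. l t * pmf (next_direction \<kappa> d) e) P"
    and markov: "\<And>d e. d \<in> directions \<Longrightarrow> e \<in> directions \<Longrightarrow>
      \<P>(\<omega> in M. \<omega> \<in> A \<and> D s \<omega> = d \<and> D t \<omega> = e) = \<P>(\<omega> in M. \<omega> \<in> A \<and> D s \<omega> = d) * P s t d e"
    using D A' st unfolding markov_jump_process_def by force
  have fin: "finite (velocity_directions j)" for j
    by simp
  have t: "0 < t" using st by simp
  have V: "velocity_z D u \<omega> = k \<longleftrightarrow> D u \<omega> \<in> velocity_directions k" if "\<omega> \<in> space M" "u > 0" for u \<omega> k
    using measurable_space[OF meas[OF that(2)] that(1)] by (simp add: velocity_z_def)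
  have meas1: "{\<omega> \<in> space M. \<omega> \<in> A \<and> D s \<omega> = d} \<in> sets M" if "d \<in> directions" for d
  proof -
    have "A \<inter> {\<omega> \<in> space M. D s \<omega> = d} \<in> sets M"
      using \<open>A \<in> sets M\<close> ev[OF that st(1)] by auto
    then show ?thesis by (rule back_subst[of "\<lambda>X. X \<in> sets M"]) auto
  qed
  have meas2: "{\<omega> \<in> space M. (\<omega> \<in> A \<and> D s \<omega> = d) \<and> D t \<omega> = e} \<in> sets M"
    if "d \<in> directions" "e \<in> directions" for d e
  proof -
    have "{\<omega> \<in> space M. \<omega> \<in> A \<and> D s \<omega> = d} \<inter> {\<omega> \<in> space M. D t \<omega> = e} \<in> sets M"
      using meas1[OF that(1)] ev[OF that(2) t] by auto
    then show ?thesis by (rule back_subst[of "\<lambda>X. X \<in> sets M"]) auto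
  qed
  have meas3: "{\<omega> \<in> space M. (\<omega> \<in> A \<and> D t \<omega> \<in> velocity_directions j) \<and> D s \<omega> = d} \<in> sets M"
    if "d \<in> directions" for d
  proof -
    have "(\<Union>e\<in>velocity_directions j. {\<omega> \<in> space M. (\<omega> \<in> A \<and> D s \<omega> = d) \<and> D t \<omega> = e}) \<in> sets M"
      using meas2[OF that] by (intro sets.finite_UN) auto
    then show ?thesis by (rule back_subst[of "\<lambda>X. X \<in> sets M"]) auto
  qed
  have "\<P>(\<omega> in M. \<omega> \<in> A \<and> velocity_z D s \<omega> = i \<and> velocity_z D t \<omega> = j) =
      \<P>(\<omega> in M. (\<omega> \<in> A \<and> D t \<omega> \<in> velocity_directions j) \<and> D s \<omega> \<in> velocity_directions i)"
    by (intro arg_cong[where f = prob] Collect_cong) (use V st t in blast)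
  also have "\<dots> = (\<Sum>d\<in>velocity_directions i. \<P>(\<omega> in M. (\<omega> \<in> A \<and> D t \<omega> \<in> velocity_directions j) \<and> D s \<omega> = d))"
    by (rule measure_sum_values[OF fin]) (use meas3 in simp)
  also have "\<dots> = (\<Sum>d\<in>velocity_directions i. \<P>(\<omega> in M. \<omega> \<in> A \<and> D s \<omega> = d) *
      two_state_kernel (exp (- b \<kappa> * (H t - H s))) i j)"
  proof (rule sum.cong[OF refl])
    fix d assume d: "d \<in> velocity_directions i"
    have "\<P>(\<omega> in M. (\<omega> \<in> A \<and> D t \<omega> \<in> velocity_directions j) \<and> D s \<omega> = d) =
      \<P>(\<omega> in M. (\<omega> \<in> A \<and> D s \<omega> = d) \<and> D t \<omega> \<in> velocity_directions j)"
      by (intro arg_cong[where f = prob] Collect_cong) blast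
    also have "\<dots> = (\<Sum>e\<in>velocity_directions j. \<P>(\<omega> in M. (\<omega> \<in> A \<and> D s \<omega> = d) \<and> D t \<omega> = e))"
      by (rule measure_sum_values[OF fin]) (use meas2 d in simp)
    also have "\<dots> = (\<Sum>e\<in>velocity_directions j. \<P>(\<omega> in M. \<omega> \<in> A \<and> D s \<omega> = d) * P s t d e)"
      using d by (intro sum.cong refl) (simp add: markov conj_assoc)
    also have "\<dots> = \<P>(\<omega> in M. \<omega> \<in> A \<and> D s \<omega> = d) * two_state_kernel (exp (- b \<kappa> * (H t - H s))) i j"
      using direction_transition_velocity[OF P H st _ j, of d] d
      by (simp add: sum_distrib_left[symmetric] b_def)
    finally show "\<P>(\<omega> in M. (\<omega> \<in> A \<and> D t \<omega> \<in> velocity_directions j) \<and> D s \<omega> = d) =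
      \<P>(\<omega> in M. \<omega> \<in> A \<and> D s \<omega> = d) * two_state_kernel (exp (- b \<kappa> * (H t - H s))) i j" .
  qed
  also have "\<dots> = (\<Sum>d\<in>velocity_directions i. \<P>(\<omega> in M. \<omega> \<in> A \<and> D s \<omega> = d)) *
      two_state_kernel (exp (- b \<kappa> * (H t - H s))) i j"
    by (simp only: sum_distrib_right)
  also have "(\<Sum>d\<in>velocity_directions i. \<P>(\<omega> in M. \<omega> \<in> A \<and> D s \<omega> = d)) =
      \<P>(\<omega> in M. \<omega> \<in> A \<and> D s \<omega> \<in> velocity_directions i)"
    by (rule measure_sum_values[OF fin, symmetric]) (use meas1 in simp)
  also have "\<dots> = \<P>(\<omega> in M. \<omega> \<in> A \<and> velocity_z D s \<omega> = i)"
    by (intro arg_cong[where f = prob] Collect_cong) (use V st in blast)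
  finally show ?thesis .
qed

section \<open>Cumulative rates\<close>

lemma primitive_on_positive_reals:
  fixes l :: "real \<Rightarrow> real"
  assumes "continuous_on {0<..} l"
  obtains F where "\<And>t. t > 0 \<Longrightarrow> (F has_real_derivative l t) (at t)"
proof -
  have "isCont l x" if "x > 0" for x
    using assms that by (simp add: continuous_on_eq_continuous_at)
  then have "\<exists>F. \<forall>x. 0 < ereal x \<longrightarrow> ereal x < \<infinity> \<longrightarrow> (F has_vector_derivative l x) (at x)"
    by (intro einterval_antiderivative) auto
  then show ?thesis
    by (auto simp: has_real_derivative_iff_has_vector_derivative[symmetric] intro: that)
qed

lemma finite_rate_set_integrable:
  assumes l: "continuous_on {0<..} l" "\<And>t. t > 0 \<Longrightarrow> l t > 0" and fin: "finite_rate l"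
  shows "set_integrable lborel {0<..t} l"
proof (cases "t > 0")
  case True
  have "set_borel_measurable borel {0<..} l"
    unfolding set_borel_measurable_def using l by (intro borel_measurable_continuous_on_indicator) auto
  then have "set_borel_measurable borel {0<..t} l"
    by (rule set_borel_measurable_subset) auto
  then have m: "(\<lambda>s. indicator {0<..t} s *\<^sub>R l s) \<in> borel_measurable lborel"
    by (simp add: set_borel_measurable_def)
  have eq: "ennreal (norm (indicator {0<..t} s *\<^sub>R l s)) = ennreal (l s) * indicator {0<..t} s" for s
    using l(2)[of s] by (auto simp: indicator_def)
  have "(\<integral>\<^sup>+s. ennreal (norm (indicator {0<..t} s *\<^sub>R l s)) \<partial>lborel) < \<infinity>"
    unfolding eq using fin True by (simp add: finite_rate_def cumulative_rate_def)
  then show ?thesis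
    unfolding set_integrable_def using m by (intro integrableI_bounded) auto
qed (simp add: set_integrable_def)

text \<open>At positive times the derivative is inherited from an antiderivative \<open>F\<close>
  with the same increments. Continuity at 0 is a separate matter: it is that of an indefinite
  integral on \<open>{0..1}\<close>, after passing from half-open to closed intervals.\<close>

lemma cumulative_rate_primitive:
  fixes l :: "real \<Rightarrow> real"
  assumes l: "continuous_on {0<..} l" "\<And>t. t > 0 \<Longrightarrow> l t > 0" and fin: "finite_rate l"
  defines "H \<equiv> \<lambda>t. LBINT u:{0<..t}. l u"
  shows "\<And>s t. 0 \<le> s \<Longrightarrow> s \<le> t \<Longrightarrow> (LBINT u:{s<..t}. l u) = H t - H s"
    and "continuous_on {0..} H"
    and "\<And>t. t > 0 \<Longrightarrow> (H has_real_derivative l t) (at t)"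
proof -
  note int = finite_rate_set_integrable[OF l fin]
  show incr: "(LBINT u:{s<..t}. l u) = H t - H s" if "0 \<le> s" "s \<le> t" for s t
  proof -
    have "(LBINT u:{0<..s} \<union> {s<..t}. l u) = (LBINT u:{0<..s}. l u) + (LBINT u:{s<..t}. l u)"
      by (intro set_integral_Un int set_integrable_subset[OF int[of t]]) (use that in auto)
    moreover have "{0<..s} \<union> {s<..t} = {0<..t}" using that by auto
    ultimately show ?thesis by (simp add: H_def)
  qed
  obtain F where F: "\<And>t. t > 0 \<Longrightarrow> (F has_real_derivative l t) (at t)"
    using primitive_on_positive_reals[OF l(1)] by blast
  have HF: "H t - H s = F t - F s" if "0 < s" "s \<le> t" for s t
  proof -
    have "set_integrable lborel {s<..t} l"
      by (rule set_integrable_subset[OF int[of t]]) (use that in auto)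
    then have "(LBINT u:{s<..t}. l u) = integral {s<..t} l"
      by (rule set_borel_integral_eq_integral)
    also have "\<dots> = integral {s..t} l"
    proof (rule integral_spike_set)
      show "negligible {x \<in> {s<..t} - {s..t}. l x \<noteq> 0}"
        by (rule negligible_subset[of "{s}"]) auto
      show "negligible {x \<in> {s..t} - {s<..t}. l x \<noteq> 0}"
        by (rule negligible_subset[of "{s}"]) auto
    qed
    also have "\<dots> = F t - F s"
      using that by (intro integral_unique fundamental_theorem_of_calculus)
        (auto simp: has_real_derivative_iff_has_vector_derivative[symmetric]
          intro!: has_field_derivative_at_within F)
    finally show ?thesis
      using incr[of s t] that by simp
  qed
  \<comment> \<open>Increments are compared at positive times only, so the additive constant is read
    off at 1 instead of 0.\<close>
  show H': "(H has_real_derivative l t) (at t)" if "t > 0" for t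
  proof (rule has_field_derivative_transform_within_open[of "\<lambda>u. F u + (H 1 - F 1)" _ _ "{0<..}"])
    show "((\<lambda>u. F u + (H 1 - F 1)) has_real_derivative l t) (at t)"
      using F[OF that] by (auto intro!: derivative_eq_intros)
    show "F u + (H 1 - F 1) = H u" if "u \<in> {0<..}" for u
      using HF[of u 1] HF[of 1 u] that by (cases "u \<le> 1") auto
  qed (use that in auto)
  have spike: "integral {0<..t} l = integral {0..t} l" for t
  proof (rule integral_spike_set)
    show "negligible {x \<in> {0<..t} - {0..t}. l x \<noteq> 0}"
      by (rule negligible_subset[of "{0}"]) auto
    show "negligible {x \<in> {0..t} - {0<..t}. l x \<noteq> 0}"
      by (rule negligible_subset[of "{0}"]) auto
  qed
  have Hint: "H t = integral {0..t} l" for t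
    using set_borel_integral_eq_integral(2)[OF int[of t]] spike[of t] by (simp add: H_def)
  have "l integrable_on {0<..1}"
    by (rule set_borel_integral_eq_integral(1)[OF int])
  then have "l integrable_on {0..1}"
  proof (rule integrable_spike_set)
    show "negligible {x \<in> {0<..1} - {0..1}. l x \<noteq> 0}"
      by (rule negligible_subset[of "{0}"]) auto
    show "negligible {x \<in> {0..1} - {0<..1}. l x \<noteq> 0}"
      by (rule negligible_subset[of "{0}"]) auto
  qed
  then have "continuous_on {0..1} H"
    unfolding Hint[abs_def] by (rule indefinite_integral_continuous_1)
  moreover have "continuous_on {1..} H"
    by (intro DERIV_continuous_on[of _ _ l]) (auto intro!: has_field_derivative_at_within H')
  ultimately have "continuous_on ({0..1} \<union> {1..}) H"
    by (intro continuous_on_closed_Un) auto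
  moreover have "{0..1} \<union> {1..} = {0::real..}" by auto
  ultimately show "continuous_on {0..} H" by simp
qed

section \<open>Directions chosen at the events of a Poisson process\<close>

text \<open>Probability generating function: the Poisson mean of \<open>\<rho> ^ m\<close> is
  \<open>exp (- (1 - \<rho>) * \<mu>)\<close>. For \<open>r = 0\<close> the convention
  \<open>0 ^ 0 = 1\<close> leaves exactly the case of no event.\<close>

lemma poisson_kernel_sums:
  assumes "0 < \<mu>"
  shows "(\<lambda>m. pmf (poisson_pmf \<mu>) m * two_state_kernel (r ^ m) i j) sums
    two_state_kernel (exp (- (1 - r) * \<mu>)) i j"
proof -
  have 1: "(\<lambda>m. (\<mu> * \<rho>) ^ m / fact m * exp (- \<mu>)) sums exp (- (1 - \<rho>) * \<mu>)" for \<rho>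
    using sums_mult2[OF exp_converges[of "\<mu> * \<rho>"], of "exp (- \<mu>)"]
    by (simp add: divide_inverse_commute exp_add[symmetric] algebra_simps)
  have "(\<lambda>m. a * ((\<mu> * 1) ^ m / fact m * exp (- \<mu>)) + c * ((\<mu> * r) ^ m / fact m * exp (- \<mu>)))
      sums (a * exp (- (1 - 1) * \<mu>) + c * exp (- (1 - r) * \<mu>))" for a c
    by (intro sums_add sums_mult 1)
  \<comment> \<open>The kernel is \<open>a + c * \<rho>\<close> with these coefficients; the
    constant part uses the generating function at 1.\<close>
  note 2 = this[of "if j = 1 then 1/3 else 2/3" "if j = 1 then i - 1/3 else - (i - 1/3)"]
  have pmf: "pmf (poisson_pmf \<mu>) m = \<mu> ^ m / fact m * exp (- \<mu>)" for m
    using assms by (rule pmf_poisson)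
  have "a * ((\<mu> * 1) ^ m / fact m * exp (- \<mu>)) + c * ((\<mu> * r) ^ m / fact m * exp (- \<mu>)) =
      pmf (poisson_pmf \<mu>) m * (a + c * r ^ m)" for a c m
    by (simp add: pmf power_mult_distrib field_simps)
  note 2 = 2[unfolded this]
  then show ?thesis
    by (cases "j = 1") (simp_all add: two_state_kernel_def algebra_simps)
qed

section \<open>Countable splitting and extension to a generated sigma-algebra\<close>

lemma (in finite_measure) measure_sums_nat:
  fixes Y :: "'a \<Rightarrow> nat"
  assumes "\<And>n. {\<omega> \<in> space M. Q \<omega> \<and> Y \<omega> = n} \<in> sets M"
  shows "(\<lambda>n. measure M {\<omega> \<in> space M. Q \<omega> \<and> Y \<omega> = n}) sums measure M {\<omega> \<in> space M. Q \<omega>}"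
proof -
  have "{\<omega> \<in> space M. Q \<omega>} = (\<Union>n. {\<omega> \<in> space M. Q \<omega> \<and> Y \<omega> = n})" by auto
  then show ?thesis
    using assms
    by (simp only:) (rule finite_measure_UNION, auto simp: disjoint_family_on_def)
qed

text \<open>Pi-lambda argument: both sides are finite measures in \<open>A\<close>, so equality
  passes to disjoint unions, and to complements because \<open>space M\<close> is in
  \<open>E\<close>. It carries Markov identities from simple past events to the whole past.\<close>

lemma (in prob_space) prob_ratio_sigma_sets:
  assumes E: "Int_stable E" "E \<subseteq> events" "space M \<in> E"
    and G: "G \<in> events" "G' \<in> events"
    and eq: "\<And>A. A \<in> E \<Longrightarrow> prob (A \<inter> G) = w * prob (A \<inter> G')"
    and A: "A \<in> sigma_sets (space M) E"
  shows "prob (A \<inter> G) = w * prob (A \<inter> G')"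
proof -
  have sub: "E \<subseteq> Pow (space M)"
    using E(2) sets.sets_into_space by auto
  have ev: "sigma_sets (space M) E \<subseteq> events"
    by (rule sets.sigma_sets_subset[OF E(2)])
  show ?thesis
    using E(1) sub A
  proof (induction A rule: sigma_sets_induct_disjoint)
    case (compl A)
    have A: "A \<in> events" using compl ev by auto
    have *: "prob ((space M - A) \<inter> B) = prob (space M \<inter> B) - prob (A \<inter> B)" if "B \<in> events" for B
    proof -
      have "(space M - A) \<inter> B = (space M \<inter> B) - (A \<inter> B)" by auto
      then show ?thesis using A that by (simp add: finite_measure_Diff)
    qed
    show ?case
      using compl eq[OF E(3)] by (simp add: *[OF G(1)] *[OF G(2)] algebra_simps)
  next
    case (union A)
    have A: "range A \<subseteq> events" using union ev by blast
    have *: "(\<lambda>i. prob (A i \<inter> B)) sums prob ((\<Union>i. A i) \<inter> B)" if "B \<in> events" for B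
    proof -
      have "(\<lambda>i. prob (A i \<inter> B)) sums prob (\<Union>i. A i \<inter> B)"
        using A that union(1) by (intro finite_measure_UNION) (auto simp: disjoint_family_on_def)
      then show ?thesis by simp
    qed
    have "(\<lambda>i. prob (A i \<inter> G)) sums (w * prob ((\<Union>i. A i) \<inter> G'))"
      using sums_mult[OF *[OF G(2)], of w] union(3) by simp
    then show ?case
      using *[OF G(1)] sums_unique2 by blast
  qed (use eq in auto)
qed

section \<open>Lumping the chain of chosen directions\<close>

lemma direction_chain_in_directions:
  assumes "direction_chain M \<kappa> \<xi>" "\<omega> \<in> space M"
  shows "\<xi> k \<omega> \<in> directions"
  using assms measurable_space[of "\<xi> k" M "count_space directions"] by (auto simp: direction_chain_def)

lemma direction_chain_measurable:
  assumes "direction_chain M \<kappa> \<xi>"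
  shows "\<xi> k \<in> M \<rightarrow>\<^sub>M count_space UNIV"
proof -
  have "\<xi> k \<in> M \<rightarrow>\<^sub>M count_space directions"
    using assms by (simp add: direction_chain_def)
  then show ?thesis
    by (rule measurable_compose[of _ _ "count_space directions" "\<lambda>x. x"]) simp
qed

lemma direction_chain_pred:
  assumes "direction_chain M \<kappa> \<xi>"
  shows "Measurable.pred M (\<lambda>\<omega>. \<xi> k \<omega> \<in> S)" "Measurable.pred M (\<lambda>\<omega>. \<xi> k \<omega> = x)"
    "Measurable.pred M (\<lambda>\<omega>. indicator S (\<xi> k \<omega>) = (j :: real))"
  by (rule measurable_compose[OF direction_chain_measurable[OF assms]]; simp)+

text \<open>Induction on \<open>m\<close>, splitting by the first new choice \<open>e\<close>, which
  extends the prescribed history to \<open>x(Suc n := e)\<close>; hence \<open>n\<close> and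
  \<open>x\<close> must vary. Averaging an affine function of the vertical indicator over one choice
  gives an affine function again, with one more factor \<open>r\<close>.\<close>

lemma direction_chain_velocity_atom:
  assumes M: "prob_space M" and \<xi>: "direction_chain M \<kappa> \<xi>" and x: "range x \<subseteq> directions"
  shows "\<P>(\<omega> in M. (\<forall>k\<le>n. \<xi> k \<omega> = x k) \<and> \<xi> (n + m) \<omega> \<in> z_directions) =
    \<P>(\<omega> in M. \<forall>k\<le>n. \<xi> k \<omega> = x k) * (1/3 + (indicator z_directions (x n) - 1/3) * switch_eigenvalue \<kappa> ^ m)"
  using x
proof (induction m arbitrary: n x)
  case 0
  have "{\<omega> \<in> space M. (\<forall>k\<le>n. \<xi> k \<omega> = x k) \<and> \<xi> (n + 0) \<omega> \<in> z_directions} =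
      (if x n \<in> z_directions then {\<omega> \<in> space M. \<forall>k\<le>n. \<xi> k \<omega> = x k} else {})"
    by auto
  then show ?case by simp
next
  case (Suc m)
  interpret prob_space M by fact
  note [measurable] = direction_chain_pred[OF \<xi>]
  let ?r = "switch_eigenvalue \<kappa>" and ?y = "\<lambda>e. x(Suc n := e)"
  \<comment> \<open>Composing one choice with \<open>m\<close> further ones multiplies their factors
    \<open>r\<close> and \<open>\<rho>\<close>; the 1 is the total mass of the choice.\<close>
  have alg: "p * ((1 - \<rho>) / 3 * 1 + \<rho> * (1/3 + (i - 1/3) * r)) = p * (1/3 + (i - 1/3) * (r * \<rho>))"
    for p \<rho> i r :: real by (simp add: field_simps)
  have sp: "\<xi> k \<omega> \<in> directions" if "\<omega> \<in> space M" for k \<omega>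
    by (rule direction_chain_in_directions[OF \<xi> that])
  have "\<P>(\<omega> in M. (\<forall>k\<le>n. \<xi> k \<omega> = x k) \<and> \<xi> (n + Suc m) \<omega> \<in> z_directions) =
    \<P>(\<omega> in M. ((\<forall>k\<le>n. \<xi> k \<omega> = x k) \<and> \<xi> (n + Suc m) \<omega> \<in> z_directions) \<and> \<xi> (Suc n) \<omega> \<in> directions)"
    by (intro arg_cong[where f = prob] Collect_cong) (simp add: sp cong: conj_cong)
  also have "\<dots> = (\<Sum>e\<in>directions.
      \<P>(\<omega> in M. ((\<forall>k\<le>n. \<xi> k \<omega> = x k) \<and> \<xi> (n + Suc m) \<omega> \<in> z_directions) \<and> \<xi> (Suc n) \<omega> = e))"
    by (rule measure_sum_values) (simp_all, measurable)
  also have "\<dots> = (\<Sum>e\<in>directions. \<P>(\<omega> in M. \<forall>k\<le>n. \<xi> k \<omega> = x k) *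
      (pmf (next_direction \<kappa> (x n)) e * (1/3 + (indicator z_directions e - 1/3) * ?r ^ m)))"
  proof (rule sum.cong[OF refl])
    fix e assume e: "e \<in> directions"
    have y: "range (?y e) \<subseteq> directions" using Suc.prems e by auto
    have atom: "(\<forall>k\<le>Suc n. \<xi> k \<omega> = ?y e k) \<longleftrightarrow> (\<forall>k\<le>n. \<xi> k \<omega> = x k) \<and> \<xi> (Suc n) \<omega> = e" for \<omega>
      by (auto simp: le_Suc_eq)
    have "\<P>(\<omega> in M. ((\<forall>k\<le>n. \<xi> k \<omega> = x k) \<and> \<xi> (n + Suc m) \<omega> \<in> z_directions) \<and> \<xi> (Suc n) \<omega> = e) =
      \<P>(\<omega> in M. (\<forall>k\<le>Suc n. \<xi> k \<omega> = ?y e k) \<and> \<xi> (Suc n + m) \<omega> \<in> z_directions)"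
      unfolding atom by (intro arg_cong[where f = prob] Collect_cong) auto
    also have "\<dots> = \<P>(\<omega> in M. \<forall>k\<le>Suc n. \<xi> k \<omega> = ?y e k) *
        (1/3 + (indicator z_directions e - 1/3) * ?r ^ m)"
      using Suc.IH[OF y, of "Suc n"] by simp
    also have "\<P>(\<omega> in M. \<forall>k\<le>Suc n. \<xi> k \<omega> = ?y e k) =
        \<P>(\<omega> in M. \<forall>k\<le>n. \<xi> k \<omega> = ?y e k) * pmf (next_direction \<kappa> (?y e n)) (?y e (Suc n))"
      using \<xi> y unfolding direction_chain_def by blast
    also have "\<P>(\<omega> in M. \<forall>k\<le>n. \<xi> k \<omega> = ?y e k) = \<P>(\<omega> in M. \<forall>k\<le>n. \<xi> k \<omega> = x k)"
      by (intro arg_cong[where f = prob] Collect_cong) auto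
    finally show "\<P>(\<omega> in M. ((\<forall>k\<le>n. \<xi> k \<omega> = x k) \<and> \<xi> (n + Suc m) \<omega> \<in> z_directions) \<and> \<xi> (Suc n) \<omega> = e) =
      \<P>(\<omega> in M. \<forall>k\<le>n. \<xi> k \<omega> = x k) *
      (pmf (next_direction \<kappa> (x n)) e * (1/3 + (indicator z_directions e - 1/3) * ?r ^ m))"
      by simp
  qed
  also have "\<dots> = \<P>(\<omega> in M. \<forall>k\<le>n. \<xi> k \<omega> = x k) * (\<Sum>e\<in>directions.
      (1 - ?r ^ m) / 3 * pmf (next_direction \<kappa> (x n)) e +
      ?r ^ m * (if e \<in> z_directions then pmf (next_direction \<kappa> (x n)) e else 0))"
    unfolding sum_distrib_left[symmetric]
    by (intro arg_cong2[where f = "(*)"] refl sum.cong) (simp add: indicator_def field_simps)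
  also have "(\<Sum>e\<in>directions. (1 - ?r ^ m) / 3 * pmf (next_direction \<kappa> (x n)) e +
      ?r ^ m * (if e \<in> z_directions then pmf (next_direction \<kappa> (x n)) e else 0)) =
      (1 - ?r ^ m) / 3 * (\<Sum>e\<in>directions. pmf (next_direction \<kappa> (x n)) e) +
      ?r ^ m * (\<Sum>e\<in>directions. if e \<in> z_directions then pmf (next_direction \<kappa> (x n)) e else 0)"
    by (simp only: sum.distrib sum_distrib_left)
  also have "(\<Sum>e\<in>directions. if e \<in> z_directions then pmf (next_direction \<kappa> (x n)) e else 0) =
      (\<Sum>e\<in>z_directions. pmf (next_direction \<kappa> (x n)) e)"
    using z_directions_subset by (simp add: sum.inter_restrict[symmetric] Int_absorb1)
  also have "\<dots> = 1/3 + (indicator z_directions (x n) - 1/3) * ?r"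
    using Suc.prems by (intro sum_pmf_next_direction_z) auto
  also have "(\<Sum>e\<in>directions. pmf (next_direction \<kappa> (x n)) e) = 1"
    using Suc.prems by (intro sum_pmf_next_direction) auto
  finally show ?case
    unfolding power_Suc alg .
qed

text \<open>Only finitely many histories up to index \<open>n\<close> exist, so an arbitrary
  \<open>B\<close> reduces to single histories. Those ending with velocity \<open>i\<close> all
  carry the same factor, and velocity 0 at the end follows by complement.\<close>

lemma direction_chain_velocity:
  assumes M: "prob_space M" and \<xi>: "direction_chain M \<kappa> \<xi>" and j: "j \<in> {0, 1}"
  shows "\<P>(\<omega> in M. restrict (\<lambda>k. \<xi> k \<omega>) {..n} \<in> B \<and> indicator z_directions (\<xi> n \<omega>) = i \<and>
      indicator z_directions (\<xi> (n + m) \<omega>) = j) =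
    \<P>(\<omega> in M. restrict (\<lambda>k. \<xi> k \<omega>) {..n} \<in> B \<and> indicator z_directions (\<xi> n \<omega>) = i) *
      two_state_kernel (switch_eigenvalue \<kappa> ^ m) i j"
proof -
  interpret prob_space M by fact
  note [measurable] = direction_chain_pred[OF \<xi>]
  let ?r = "switch_eigenvalue \<kappa>"
  define T where "T = {y \<in> PiE {..n} (\<lambda>_. directions). y \<in> B \<and> indicator z_directions (y n) = i}"
  have "finite T"
    unfolding T_def by (rule finite_subset[of _ "PiE {..n} (\<lambda>_. directions)"]) (auto intro!: finite_PiE)
  have sp: "\<xi> k \<omega> \<in> directions" if "\<omega> \<in> space M" for k \<omega>
    by (rule direction_chain_in_directions[OF \<xi> that])
  have T: "restrict (\<lambda>k. \<xi> k \<omega>) {..n} \<in> B \<and> indicator z_directions (\<xi> n \<omega>) = i \<longleftrightarrow>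
      restrict (\<lambda>k. \<xi> k \<omega>) {..n} \<in> T" if "\<omega> \<in> space M" for \<omega>
    using sp[OF that] by (auto simp: T_def)
  have atom: "restrict (\<lambda>k. \<xi> k \<omega>) {..n} = y \<longleftrightarrow> (\<forall>k\<le>n. \<xi> k \<omega> = y k)" if "y \<in> T" for y \<omega>
    using that by (auto simp: T_def PiE_def extensional_def fun_eq_iff restrict_def)
  have meas: "{\<omega> \<in> space M. \<forall>k\<le>n. \<xi> k \<omega> = y k} \<in> events"
    "{\<omega> \<in> space M. indicator z_directions (\<xi> (n + m) \<omega>) = j \<and> (\<forall>k\<le>n. \<xi> k \<omega> = y k)} \<in> events"
    "{\<omega> \<in> space M. (\<forall>k\<le>n. \<xi> k \<omega> = y k) \<and> \<xi> (n + m) \<omega> \<in> z_directions} \<in> events" for y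
    by measurable
  have step: "\<P>(\<omega> in M. indicator z_directions (\<xi> (n + m) \<omega>) = j \<and> (\<forall>k\<le>n. \<xi> k \<omega> = y k)) =
    \<P>(\<omega> in M. \<forall>k\<le>n. \<xi> k \<omega> = y k) * two_state_kernel (?r ^ m) i j" if y: "y \<in> T" for y
  proof -
    \<comment> \<open>\<open>direction_chain\<close> speaks of full sequences of directions, while
      \<open>y\<close> is \<open>undefined\<close> beyond \<open>n\<close>; any direction can fill
      the gap.\<close>
    define x where "x k = (if k \<le> n then y k else vector [0, 0, 1])" for k
    have x: "range x \<subseteq> directions"
      using y by (auto simp: x_def T_def directions_def z_directions_def PiE_def Pi_def)
    have xy: "(\<forall>k\<le>n. \<xi> k \<omega> = x k) \<longleftrightarrow> (\<forall>k\<le>n. \<xi> k \<omega> = y k)" for \<omega>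
      by (auto simp: x_def)
    have i: "indicator z_directions (x n) = i"
      using y by (simp add: T_def x_def)
    have one: "\<P>(\<omega> in M. (\<forall>k\<le>n. \<xi> k \<omega> = y k) \<and> \<xi> (n + m) \<omega> \<in> z_directions) =
        \<P>(\<omega> in M. \<forall>k\<le>n. \<xi> k \<omega> = y k) * (1/3 + (i - 1/3) * ?r ^ m)"
      using direction_chain_velocity_atom[OF M \<xi> x, of n m] unfolding xy i .
    show ?thesis
    proof (cases "j = 1")
      case True
      have "\<P>(\<omega> in M. indicator z_directions (\<xi> (n + m) \<omega>) = j \<and> (\<forall>k\<le>n. \<xi> k \<omega> = y k)) =
          \<P>(\<omega> in M. (\<forall>k\<le>n. \<xi> k \<omega> = y k) \<and> \<xi> (n + m) \<omega> \<in> z_directions)"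
        using True by (intro arg_cong[where f = prob] Collect_cong) (auto simp: indicator_def)
      then show ?thesis
        using True one by (simp add: two_state_kernel_def)
    next
      case False
      with j have "j = 0" by simp
      then have eq: "{\<omega> \<in> space M. indicator z_directions (\<xi> (n + m) \<omega>) = j \<and> (\<forall>k\<le>n. \<xi> k \<omega> = y k)} =
          {\<omega> \<in> space M. \<forall>k\<le>n. \<xi> k \<omega> = y k} -
          {\<omega> \<in> space M. (\<forall>k\<le>n. \<xi> k \<omega> = y k) \<and> \<xi> (n + m) \<omega> \<in> z_directions}"
        by (auto simp: indicator_def)
      have "\<P>(\<omega> in M. indicator z_directions (\<xi> (n + m) \<omega>) = j \<and> (\<forall>k\<le>n. \<xi> k \<omega> = y k)) =
          \<P>(\<omega> in M. \<forall>k\<le>n. \<xi> k \<omega> = y k) -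
          \<P>(\<omega> in M. (\<forall>k\<le>n. \<xi> k \<omega> = y k) \<and> \<xi> (n + m) \<omega> \<in> z_directions)"
        unfolding eq by (rule finite_measure_Diff[OF meas(1)[of y] meas(3)[of y]]) (rule Collect_mono, simp)
      then show ?thesis
        using False unfolding one by (simp add: two_state_kernel_def algebra_simps)
    qed
  qed
  have "\<P>(\<omega> in M. restrict (\<lambda>k. \<xi> k \<omega>) {..n} \<in> B \<and> indicator z_directions (\<xi> n \<omega>) = i \<and>
      indicator z_directions (\<xi> (n + m) \<omega>) = j) =
    \<P>(\<omega> in M. indicator z_directions (\<xi> (n + m) \<omega>) = j \<and> restrict (\<lambda>k. \<xi> k \<omega>) {..n} \<in> T)"
    by (intro arg_cong[where f = prob] Collect_cong) (use T in blast)
  also have "\<dots> = (\<Sum>y\<in>T. \<P>(\<omega> in M. indicator z_directions (\<xi> (n + m) \<omega>) = j \<and> restrict (\<lambda>k. \<xi> k \<omega>) {..n} = y))"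
    by (rule measure_sum_values[OF \<open>finite T\<close>]) (simp add: atom meas)
  \<comment> \<open>The conjunct \<open>True\<close> gives the event the shape that
    \<open>measure_sum_values\<close> expects.\<close>
  also have "\<dots> = (\<Sum>y\<in>T. \<P>(\<omega> in M. True \<and> restrict (\<lambda>k. \<xi> k \<omega>) {..n} = y) * two_state_kernel (?r ^ m) i j)"
    by (rule sum.cong) (simp_all add: atom step)
  also have "\<dots> = (\<Sum>y\<in>T. \<P>(\<omega> in M. True \<and> restrict (\<lambda>k. \<xi> k \<omega>) {..n} = y)) * two_state_kernel (?r ^ m) i j"
    by (simp only: sum_distrib_right)
  also have "(\<Sum>y\<in>T. \<P>(\<omega> in M. True \<and> restrict (\<lambda>k. \<xi> k \<omega>) {..n} = y)) =
      \<P>(\<omega> in M. True \<and> restrict (\<lambda>k. \<xi> k \<omega>) {..n} \<in> T)"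
    by (rule measure_sum_values[OF \<open>finite T\<close>, symmetric]) (simp add: atom meas)
  also have "\<dots> = \<P>(\<omega> in M. restrict (\<lambda>k. \<xi> k \<omega>) {..n} \<in> B \<and> indicator z_directions (\<xi> n \<omega>) = i)"
    by (intro arg_cong[where f = prob] Collect_cong) (use T in blast)
  finally show ?thesis .
qed

section \<open>Events determined by finitely many coordinates\<close>

lemma restrict_measurable_count_space:
  assumes "finite J" "countable S" "\<And>j. j \<in> J \<Longrightarrow> X j \<in> M \<rightarrow>\<^sub>M count_space S"
  shows "(\<lambda>\<omega>. restrict (\<lambda>j. X j \<omega>) J) \<in> M \<rightarrow>\<^sub>M count_space (PiE J (\<lambda>_. S))"
  unfolding count_space_PiM_finite[OF assms(1,2), symmetric]
  by (rule measurable_restrict) (rule assms(3))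

lemma restrict_event:
  assumes "finite J" "countable S" "\<And>j. j \<in> J \<Longrightarrow> X j \<in> M \<rightarrow>\<^sub>M count_space S"
  shows "{\<omega> \<in> space M. restrict (\<lambda>j. X j \<omega>) J \<in> B} \<in> sets M"
proof -
  note r = restrict_measurable_count_space[of J S X M, OF assms]
  have "(\<lambda>\<omega>. restrict (\<lambda>j. X j \<omega>) J) -` (B \<inter> PiE J (\<lambda>_. S)) \<inter> space M \<in> sets M"
    by (rule measurable_sets[OF r]) auto
  moreover have "(\<lambda>\<omega>. restrict (\<lambda>j. X j \<omega>) J) -` (B \<inter> PiE J (\<lambda>_. S)) \<inter> space M =
      {\<omega> \<in> space M. restrict (\<lambda>j. X j \<omega>) J \<in> B}"
    using measurable_space[OF r] by auto
  ultimately show ?thesis by simp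
qed

text \<open>Independence is stated for generated sigma-algebras, so membership in
  \<open>sets M\<close> would be too weak. \<open>restrict_event\<close> is therefore applied in a
  space \<open>G\<close> whose measurable sets are exactly the generated ones.\<close>

lemma generated_sigma_restrict_event:
  assumes J: "finite J" "J \<subseteq> I" and S: "countable S" "\<And>j \<omega>. j \<in> J \<Longrightarrow> \<omega> \<in> space M \<Longrightarrow> X j \<omega> \<in> S"
  shows "{\<omega> \<in> space M. restrict (\<lambda>j. X j \<omega>) J \<in> B} \<in> generated_sigma M I X"
proof -
  define G where "G = sigma (space M) {X u -` B \<inter> space M |u B. u \<in> I}"
  have sp: "space G = space M" and sets: "sets G = generated_sigma M I X"
    unfolding G_def generated_sigma_def by (auto simp: space_measure_of_conv intro!: sets_measure_of)
  have "X j \<in> G \<rightarrow>\<^sub>M count_space S" if "j \<in> J" for j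
  proof (rule measurableI)
    show "X j \<omega> \<in> space (count_space S)" if "\<omega> \<in> space G" for \<omega>
      using S(2)[OF \<open>j \<in> J\<close>] that sp by simp
    show "X j -` A \<inter> space G \<in> sets G" for A
      unfolding sets sp generated_sigma_def using that J(2) by (intro sigma_sets.Basic) auto
  qed
  from restrict_event[of J S X G B, OF J(1) S(1) this] show ?thesis
    unfolding sp sets .
qed

text \<open>Counts at finitely many times up to \<open>s\<close> are almost surely a function of
  increments over consecutive intervals covering \<open>{0..s}\<close>, and these are independent of
  the increment from \<open>s\<close> to \<open>t\<close>.\<close>

lemma poisson_increment_past:
  assumes N: "poisson_process M l N" and F: "finite F" "F \<subseteq> {0..s}" and st: "0 \<le> s" "s < t"
  shows "\<P>(\<omega> in M. restrict (\<lambda>u. N u \<omega>) F \<in> C \<and> N t \<omega> - N s \<omega> = m) =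
    \<P>(\<omega> in M. restrict (\<lambda>u. N u \<omega>) F \<in> C) * pmf (poisson_pmf (LBINT u:{s<..t}. l u)) m"
proof -
  interpret prob_space M
    using N by (simp add: poisson_process_def)
  have N_meas: "N u \<in> M \<rightarrow>\<^sub>M count_space UNIV" if "0 \<le> u" for u
    using N that by (simp add: poisson_process_def)
  \<comment> \<open>Adjoining 0 anchors the telescoping at \<open>N 0 = 0\<close>; adjoining
    \<open>s\<close> makes it the last partition point.\<close>
  define xs where "xs = sorted_list_of_set (insert 0 (insert s F))"
  define K where "K = length xs - 1"
  have xs: "sorted xs" "set xs = insert 0 (insert s F)"
    unfolding xs_def using F(1) by (simp_all only: sorted_sorted_list_of_set set_sorted_list_of_set finite_insert)
  then have len: "length xs = Suc K"
    by (cases xs) (auto simp: K_def)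
  have mem: "xs ! i \<in> {0..s}" if "i \<le> K" for i
    using nth_mem[of i xs] that F(2) st unfolding xs(2) len by auto
  have index: "\<exists>i\<le>K. xs ! i = u" if "u \<in> insert 0 (insert s F)" for u
    using that unfolding xs(2)[symmetric] in_set_conv_nth len less_Suc_eq_le by blast
  have xs0: "xs ! 0 = 0"
  proof -
    obtain i where i: "i \<le> K" "xs ! i = 0" using index[of 0] by auto
    have "xs ! 0 \<le> xs ! i" using i len by (intro sorted_nth_mono[OF xs(1)]) auto
    then show ?thesis using i mem[of 0] by auto
  qed
  have xsK: "xs ! K = s"
  proof -
    obtain i where i: "i \<le> K" "xs ! i = s" using index[of s] by auto
    have "xs ! i \<le> xs ! K" using i len by (intro sorted_nth_mono[OF xs(1)]) auto
    then show ?thesis using i mem[of K] by auto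
  qed
  \<comment> \<open>Index \<open>K\<close> is the increment from \<open>s\<close> to
    \<open>t\<close>. Staying at \<open>t\<close> afterwards keeps the whole sequence
    monotone.\<close>
  define \<tau> where "\<tau> i = (if i \<le> K then xs ! i else t)" for i
  have "mono \<tau>"
  proof (rule monoI)
    fix i j :: nat assume ij: "i \<le> j"
    show "\<tau> i \<le> \<tau> j"
    proof (cases "j \<le> K")
      case True
      then show ?thesis
        using ij len by (auto simp: \<tau>_def intro!: sorted_nth_mono[OF xs(1)])
    next
      case False
      then show ?thesis
        using mem[of i] st by (auto simp: \<tau>_def)
    qed
  qed
  have \<tau>: "0 \<le> \<tau> i" for i
    using mem[of i] st by (simp add: \<tau>_def)
  define X where "X i \<omega> = N (\<tau> (Suc i)) \<omega> - N (\<tau> i) \<omega>" for i \<omega>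
  have "indep_vars (\<lambda>_. count_space UNIV) (\<lambda>i \<omega>. N (\<tau> (Suc i)) \<omega> - N (\<tau> i) \<omega>) {..<Suc K}"
    using N \<open>mono \<tau>\<close> \<tau>[of 0] unfolding poisson_process_def by blast
  then have ind: "indep_vars (\<lambda>_. count_space UNIV) X {..<Suc K}"
    by (simp add: X_def[abs_def])
  have indep: "indep_var (PiM {..<K} (\<lambda>_. count_space UNIV)) (\<lambda>\<omega>. restrict (\<lambda>i. X i \<omega>) {..<K})
      (PiM {K} (\<lambda>_. count_space UNIV)) (\<lambda>\<omega>. restrict (\<lambda>i. X i \<omega>) {K})"
    by (rule indep_var_restrict[OF ind]) auto
  define idx where "idx u = (SOME i. i \<le> K \<and> xs ! i = u)" for u
  have idx: "idx u \<le> K" "xs ! idx u = u" if "u \<in> F" for u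
  proof -
    have "\<exists>i. i \<le> K \<and> xs ! i = u" using index[of u] that by auto
    then show "idx u \<le> K" "xs ! idx u = u"
      unfolding idx_def by (metis (mono_tags, lifting) someI_ex)+
  qed
  \<comment> \<open>Recovers each count from the increments before it by telescoping.\<close>
  define \<Phi> where "\<Phi> y = restrict (\<lambda>u. \<Sum>k<idx u. y k) F" for y :: "nat \<Rightarrow> nat"
  have past: "AE \<omega> in M. restrict (\<lambda>u. N u \<omega>) F = \<Phi> (restrict (\<lambda>i. X i \<omega>) {..<K})"
  proof -
    have "AE \<omega> in M. N 0 \<omega> = 0 \<and> mono_on {0..} (\<lambda>t. N t \<omega>)"
      using N by (auto simp: poisson_process_def)
    then show ?thesis
    proof eventually_elim
      case (elim \<omega>)
      have sum: "N (xs ! i) \<omega> = (\<Sum>k<i. X k \<omega>)" if "i \<le> K" for i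
        using that
      proof (induction i)
        case 0
        then show ?case using elim by (simp add: xs0)
      next
        case (Suc i)
        \<comment> \<open>Subtraction on naturals is truncated; monotonicity makes the increments
          add up.\<close>
        have "N (\<tau> i) \<omega> \<le> N (\<tau> (Suc i)) \<omega>"
          using elim \<open>mono \<tau>\<close> \<tau> by (auto simp: mono_on_def mono_def)
        then show ?case
          using Suc by (simp add: X_def \<tau>_def)
      qed
      have "N u \<omega> = (\<Sum>k<idx u. restrict (\<lambda>i. X i \<omega>) {..<K} k)" if "u \<in> F" for u
        using sum[OF idx(1)[OF that]] idx[OF that] by simp
      then show ?case
        unfolding \<Phi>_def by (intro restrict_ext) auto
    qed
  qed
  define C1 where "C1 = {y \<in> PiE {..<K} (\<lambda>_. UNIV). \<Phi> y \<in> C}"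
  define C2 where "C2 = {y \<in> PiE {K} (\<lambda>_. UNIV). y K = m}"
  have sets: "C1 \<in> sets (PiM {..<K} (\<lambda>_. count_space UNIV))" "C2 \<in> sets (PiM {K} (\<lambda>_. count_space UNIV))"
    by (subst count_space_PiM_finite; auto simp: C1_def C2_def)+
  have meas: "(\<lambda>\<omega>. restrict (\<lambda>i. X i \<omega>) {..<K}) \<in> M \<rightarrow>\<^sub>M PiM {..<K} (\<lambda>_. count_space UNIV)"
    "(\<lambda>\<omega>. restrict (\<lambda>i. X i \<omega>) {K}) \<in> M \<rightarrow>\<^sub>M PiM {K} (\<lambda>_. count_space UNIV)"
    using indep by (auto simp: indep_var_eq)
  have X: "restrict (\<lambda>i. X i \<omega>) {..<K} \<in> C1 \<longleftrightarrow> \<Phi> (restrict (\<lambda>i. X i \<omega>) {..<K}) \<in> C"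
    "restrict (\<lambda>i. X i \<omega>) {K} \<in> C2 \<longleftrightarrow> N t \<omega> - N s \<omega> = m" for \<omega>
    by (auto simp: C1_def C2_def X_def \<tau>_def xsK)
  have evX: "(\<lambda>\<omega>. restrict (\<lambda>i. X i \<omega>) {..<K}) -` C1 \<inter> space M \<in> events"
    "(\<lambda>\<omega>. restrict (\<lambda>i. X i \<omega>) {K}) -` C2 \<inter> space M \<in> events"
    using measurable_sets[OF meas(1) sets(1)] measurable_sets[OF meas(2) sets(2)] .
  have evN: "{\<omega> \<in> space M. restrict (\<lambda>u. N u \<omega>) F \<in> C} \<in> events"
    by (rule restrict_event[where S = UNIV]) (use F N_meas in auto)
  have eq2: "(\<lambda>\<omega>. restrict (\<lambda>i. X i \<omega>) {K}) -` C2 \<inter> space M = {\<omega> \<in> space M. N t \<omega> - N s \<omega> = m}"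
    using X(2) by auto
  have evN2: "{\<omega> \<in> space M. N t \<omega> - N s \<omega> = m} \<in> events"
    using evX(2) unfolding eq2 .
  have "\<P>(\<omega> in M. restrict (\<lambda>u. N u \<omega>) F \<in> C \<and> N t \<omega> - N s \<omega> = m) =
    prob ((\<lambda>\<omega>. (restrict (\<lambda>i. X i \<omega>) {..<K}, restrict (\<lambda>i. X i \<omega>) {K})) -` (C1 \<times> C2) \<inter> space M)"
  proof (rule finite_measure_eq_AE)
    show "AE \<omega> in M. \<omega> \<in> {\<omega> \<in> space M. restrict (\<lambda>u. N u \<omega>) F \<in> C \<and> N t \<omega> - N s \<omega> = m} \<longleftrightarrow>
      \<omega> \<in> (\<lambda>\<omega>. (restrict (\<lambda>i. X i \<omega>) {..<K}, restrict (\<lambda>i. X i \<omega>) {K})) -` (C1 \<times> C2) \<inter> space M"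
      using past by eventually_elim (simp add: X conj_commute conj_left_commute)
    have "{\<omega> \<in> space M. restrict (\<lambda>u. N u \<omega>) F \<in> C} \<inter> {\<omega> \<in> space M. N t \<omega> - N s \<omega> = m} \<in> events"
      using evN evN2 by auto
    moreover have "{\<omega> \<in> space M. restrict (\<lambda>u. N u \<omega>) F \<in> C} \<inter> {\<omega> \<in> space M. N t \<omega> - N s \<omega> = m} =
      {\<omega> \<in> space M. restrict (\<lambda>u. N u \<omega>) F \<in> C \<and> N t \<omega> - N s \<omega> = m}" by auto
    ultimately show "{\<omega> \<in> space M. restrict (\<lambda>u. N u \<omega>) F \<in> C \<and> N t \<omega> - N s \<omega> = m} \<in> events" by simp
    have "((\<lambda>\<omega>. restrict (\<lambda>i. X i \<omega>) {..<K}) -` C1 \<inter> space M) \<inter>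
        ((\<lambda>\<omega>. restrict (\<lambda>i. X i \<omega>) {K}) -` C2 \<inter> space M) \<in> events"
      using evX by auto
    moreover have "((\<lambda>\<omega>. restrict (\<lambda>i. X i \<omega>) {..<K}) -` C1 \<inter> space M) \<inter>
        ((\<lambda>\<omega>. restrict (\<lambda>i. X i \<omega>) {K}) -` C2 \<inter> space M) =
      (\<lambda>\<omega>. (restrict (\<lambda>i. X i \<omega>) {..<K}, restrict (\<lambda>i. X i \<omega>) {K})) -` (C1 \<times> C2) \<inter> space M" by auto
    ultimately show "(\<lambda>\<omega>. (restrict (\<lambda>i. X i \<omega>) {..<K}, restrict (\<lambda>i. X i \<omega>) {K})) -` (C1 \<times> C2) \<inter> space M \<in> events"
      by simp
  qed
  also have "\<dots> = prob ((\<lambda>\<omega>. restrict (\<lambda>i. X i \<omega>) {..<K}) -` C1 \<inter> space M) *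
      prob ((\<lambda>\<omega>. restrict (\<lambda>i. X i \<omega>) {K}) -` C2 \<inter> space M)"
    by (rule indep_varD[OF indep sets])
  also have "prob ((\<lambda>\<omega>. restrict (\<lambda>i. X i \<omega>) {..<K}) -` C1 \<inter> space M) =
      \<P>(\<omega> in M. restrict (\<lambda>u. N u \<omega>) F \<in> C)"
  proof (rule finite_measure_eq_AE[OF _ evX(1) evN])
    show "AE \<omega> in M. \<omega> \<in> (\<lambda>\<omega>. restrict (\<lambda>i. X i \<omega>) {..<K}) -` C1 \<inter> space M \<longleftrightarrow>
      \<omega> \<in> {\<omega> \<in> space M. restrict (\<lambda>u. N u \<omega>) F \<in> C}"
      using past by eventually_elim (simp add: X conj_commute)
  qed
  also have "prob ((\<lambda>\<omega>. restrict (\<lambda>i. X i \<omega>) {K}) -` C2 \<inter> space M) = pmf (poisson_pmf (LBINT u:{s<..t}. l u)) m"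
  proof -
    have d: "distr M (count_space UNIV) (\<lambda>\<omega>. N t \<omega> - N s \<omega>) = measure_pmf (poisson_pmf (LBINT u:{s<..t}. l u))"
      using N st by (simp add: poisson_process_def)
    have "X K \<in> M \<rightarrow>\<^sub>M count_space UNIV"
      using ind by (auto simp: indep_vars_def)
    then have mX: "(\<lambda>\<omega>. N t \<omega> - N s \<omega>) \<in> M \<rightarrow>\<^sub>M count_space UNIV"
      by (simp add: X_def[abs_def] \<tau>_def xsK)
    have "pmf (poisson_pmf (LBINT u:{s<..t}. l u)) m = measure (distr M (count_space UNIV) (\<lambda>\<omega>. N t \<omega> - N s \<omega>)) {m}"
      unfolding d by (simp add: pmf.rep_eq)
    also have "\<dots> = prob ((\<lambda>\<omega>. N t \<omega> - N s \<omega>) -` {m} \<inter> space M)"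
      by (rule measure_distr[OF mX]) simp
    also have "(\<lambda>\<omega>. N t \<omega> - N s \<omega>) -` {m} \<inter> space M = {\<omega> \<in> space M. N t \<omega> - N s \<omega> = m}"
      by auto
    finally show ?thesis
      unfolding eq2 by simp
  qed
  finally show ?thesis .
qed

text \<open>Rectangles for a fixed \<open>n\<close>: a condition on the directions up to index
  \<open>n\<close> and one on finitely many counts, so that independence of \<open>\<xi>\<close> and
  \<open>N\<close> can act. Arbitrary \<open>B\<close> and \<open>C\<close> are harmless, because
  these histories range over countable discrete spaces.\<close>

definition past_events ::
  "'w measure \<Rightarrow> (nat \<Rightarrow> 'w \<Rightarrow> real ^ 3) \<Rightarrow> (real \<Rightarrow> 'w \<Rightarrow> nat) \<Rightarrow> nat \<Rightarrow> real \<Rightarrow> 'w set set" where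
  "past_events M \<xi> N n s =
    {{\<omega> \<in> space M. restrict (\<lambda>k. \<xi> k \<omega>) {..n} \<in> B \<and> restrict (\<lambda>u. N u \<omega>) F \<in> C} |B C F.
      finite F \<and> F \<subseteq> {0..s}}"

lemma Int_stable_past_events: "Int_stable (past_events M \<xi> N n s)"
proof (rule Int_stableI)
  fix A A' assume "A \<in> past_events M \<xi> N n s" "A' \<in> past_events M \<xi> N n s"
  then obtain B C F B' C' F' where F: "finite F" "F \<subseteq> {0..s}" "finite F'" "F' \<subseteq> {0..s}"
    and A: "A = {\<omega> \<in> space M. restrict (\<lambda>k. \<xi> k \<omega>) {..n} \<in> B \<and> restrict (\<lambda>u. N u \<omega>) F \<in> C}"
    and A': "A' = {\<omega> \<in> space M. restrict (\<lambda>k. \<xi> k \<omega>) {..n} \<in> B' \<and> restrict (\<lambda>u. N u \<omega>) F' \<in> C'}"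
    unfolding past_events_def by blast
  have "A \<inter> A' = {\<omega> \<in> space M. restrict (\<lambda>k. \<xi> k \<omega>) {..n} \<in> B \<inter> B' \<and>
      restrict (\<lambda>u. N u \<omega>) (F \<union> F') \<in> {y. restrict y F \<in> C \<and> restrict y F' \<in> C'}}"
    unfolding A A' by (auto simp: Int_absorb1)
  then show "A \<inter> A' \<in> past_events M \<xi> N n s"
    unfolding past_events_def using F by blast
qed

lemma direction_chain_generated:
  assumes "direction_chain M \<kappa> \<xi>"
  shows "{\<omega> \<in> space M. restrict (\<lambda>k. \<xi> k \<omega>) {..n} \<in> B} \<in> generated_sigma M UNIV \<xi>"
  by (rule generated_sigma_restrict_event[where S = directions])
    (auto intro: countable_finite direction_chain_in_directions[OF assms])

lemma past_events_generated:
  assumes ind: "prob_space.indep_set M (generated_sigma M UNIV \<xi>) (generated_sigma M {0..} N)"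
    and M: "prob_space M" and \<xi>: "direction_chain M \<kappa> \<xi>"
  shows "past_events M \<xi> N n s \<subseteq> sets M"
proof
  interpret prob_space M by fact
  fix A assume "A \<in> past_events M \<xi> N n s"
  then obtain B C F where F: "finite F" "F \<subseteq> {0..s}"
    and A: "A = {\<omega> \<in> space M. restrict (\<lambda>k. \<xi> k \<omega>) {..n} \<in> B \<and> restrict (\<lambda>u. N u \<omega>) F \<in> C}"
    unfolding past_events_def by blast
  have "{\<omega> \<in> space M. restrict (\<lambda>k. \<xi> k \<omega>) {..n} \<in> B} \<in> events"
    using direction_chain_generated[OF \<xi>] indep_setD_ev1[OF ind] by auto
  moreover have "{\<omega> \<in> space M. restrict (\<lambda>u. N u \<omega>) F \<in> C} \<in> generated_sigma M {0..} N"
    by (rule generated_sigma_restrict_event[where S = UNIV]) (use F in auto)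
  then have "{\<omega> \<in> space M. restrict (\<lambda>u. N u \<omega>) F \<in> C} \<in> events"
    using indep_setD_ev2[OF ind] by auto
  ultimately have "{\<omega> \<in> space M. restrict (\<lambda>k. \<xi> k \<omega>) {..n} \<in> B} \<inter>
      {\<omega> \<in> space M. restrict (\<lambda>u. N u \<omega>) F \<in> C} \<in> events" by auto
  moreover have "{\<omega> \<in> space M. restrict (\<lambda>k. \<xi> k \<omega>) {..n} \<in> B} \<inter>
      {\<omega> \<in> space M. restrict (\<lambda>u. N u \<omega>) F \<in> C} = A" unfolding A by auto
  ultimately show "A \<in> sets M" by simp
qed

text \<open>On a rectangle, the event on the left is a chain event intersected with a counting
  event. \<open>direction_chain_velocity\<close> supplies the kernel,
  \<open>poisson_increment_past\<close> the Poisson weight, and independence factors both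
  sides.\<close>

lemma past_events_markov:
  assumes N: "poisson_process M l N" and \<xi>: "direction_chain M \<kappa> \<xi>"
    and ind: "prob_space.indep_set M (generated_sigma M UNIV \<xi>) (generated_sigma M {0..} N)"
    and st: "0 \<le> s" "s < t" and j: "j \<in> {0, 1}" and A: "A \<in> past_events M \<xi> N n s"
  shows "measure M (A \<inter> {\<omega> \<in> space M. N s \<omega> = n \<and> N t \<omega> - N s \<omega> = m \<and>
      indicator z_directions (\<xi> n \<omega>) = i \<and> indicator z_directions (\<xi> (n + m) \<omega>) = j}) =
    pmf (poisson_pmf (LBINT u:{s<..t}. l u)) m * two_state_kernel (switch_eigenvalue \<kappa> ^ m) i j *
    measure M (A \<inter> {\<omega> \<in> space M. N s \<omega> = n \<and> indicator z_directions (\<xi> n \<omega>) = i})"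
proof -
  have M: "prob_space M" using N by (simp add: poisson_process_def)
  interpret prob_space M by fact
  obtain B C F where F: "finite F" "F \<subseteq> {0..s}"
    and A: "A = {\<omega> \<in> space M. restrict (\<lambda>k. \<xi> k \<omega>) {..n} \<in> B \<and> restrict (\<lambda>u. N u \<omega>) F \<in> C}"
    using A unfolding past_events_def by blast
  let ?I = "\<lambda>k \<omega>. indicator z_directions (\<xi> k \<omega>) :: real"
  \<comment> \<open>Adjoining \<open>s\<close> to the observation times absorbs
    \<open>N s = n\<close> into the condition on the counts.\<close>
  define C' where "C' = {y. restrict y F \<in> C \<and> y s = n}"
  define E1 where "E1 = {\<omega> \<in> space M. restrict (\<lambda>k. \<xi> k \<omega>) {..n} \<in> B \<and> ?I n \<omega> = i \<and> ?I (n + m) \<omega> = j}"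
  define E1' where "E1' = {\<omega> \<in> space M. restrict (\<lambda>k. \<xi> k \<omega>) {..n} \<in> B \<and> ?I n \<omega> = i}"
  define E2 where "E2 = {\<omega> \<in> space M. restrict (\<lambda>u. N u \<omega>) (insert s F) \<in> C' \<and> N t \<omega> - N s \<omega> = m}"
  define E2' where "E2' = {\<omega> \<in> space M. restrict (\<lambda>u. N u \<omega>) (insert s F) \<in> C'}"
  have "{..n} \<inter> {..n + m} = {..n}" by auto
  then have "E1 = {\<omega> \<in> space M. restrict (\<lambda>k. \<xi> k \<omega>) {..n + m} \<in>
      {y. restrict y {..n} \<in> B \<and> indicator z_directions (y n) = i \<and> indicator z_directions (y (n + m)) = j}}"
    unfolding E1_def by (auto simp: Int_commute)
  then have E1: "E1 \<in> generated_sigma M UNIV \<xi>"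
    by (simp only: direction_chain_generated[OF \<xi>])
  have "E1' = {\<omega> \<in> space M. restrict (\<lambda>k. \<xi> k \<omega>) {..n} \<in> {y. y \<in> B \<and> indicator z_directions (y n) = i}}"
    unfolding E1'_def by auto
  then have E1': "E1' \<in> generated_sigma M UNIV \<xi>"
    by (simp only: direction_chain_generated[OF \<xi>])
  have N_ev: "{\<omega> \<in> space M. restrict (\<lambda>u. N u \<omega>) J \<in> Y} \<in> generated_sigma M {0..} N"
    if "finite J" "J \<subseteq> {0..}" for J Y
    by (rule generated_sigma_restrict_event[where S = UNIV]) (use that in auto)
  have E2': "E2' \<in> generated_sigma M {0..} N"
    unfolding E2'_def by (rule N_ev) (use F st in auto)
  have "insert s F \<inter> insert s (insert t F) = insert s F" by auto
  then have "E2 = {\<omega> \<in> space M. restrict (\<lambda>u. N u \<omega>) (insert s (insert t F)) \<in>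
      {y. restrict y (insert s F) \<in> C' \<and> y t - y s = m}}"
    unfolding E2_def by (auto simp: Int_commute)
  then have E2: "E2 \<in> generated_sigma M {0..} N"
    by (simp only:) (rule N_ev, use F st in auto)
  have FF: "F \<inter> insert s F = F" "insert s F \<inter> F = F" by auto
  have C': "restrict (\<lambda>u. N u \<omega>) (insert s F) \<in> C' \<longleftrightarrow> restrict (\<lambda>u. N u \<omega>) F \<in> C \<and> N s \<omega> = n" for \<omega>
    by (simp add: C'_def FF)
  have "A \<inter> {\<omega> \<in> space M. N s \<omega> = n \<and> N t \<omega> - N s \<omega> = m \<and> ?I n \<omega> = i \<and> ?I (n + m) \<omega> = j} = E1 \<inter> E2"
    unfolding A E1_def E2_def C' by auto
  moreover have "A \<inter> {\<omega> \<in> space M. N s \<omega> = n \<and> ?I n \<omega> = i} = E1' \<inter> E2'"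
    unfolding A E1'_def E2'_def C' by auto
  moreover have "prob E1 = prob E1' * two_state_kernel (switch_eigenvalue \<kappa> ^ m) i j"
    unfolding E1_def E1'_def by (rule direction_chain_velocity[OF M \<xi> j])
  moreover have "prob E2 = prob E2' * pmf (poisson_pmf (LBINT u:{s<..t}. l u)) m"
    unfolding E2_def E2'_def by (rule poisson_increment_past[OF N]) (use F st in auto)
  ultimately show ?thesis
    using indep_setD[OF ind E1 E2] indep_setD[OF ind E1' E2'] by (simp only: mult_ac)
qed

text \<open>
  On \<open>{N s = n}\<close> only the directions \<open>\<xi> 0, \<dots>, \<xi> n\<close> have been used up to time \<open>s\<close>, hence replacing
  \<open>N u\<close> by \<open>min (N u) n\<close> turns events of the velocity's past into events of \<open>past_events\<close>.
\<close>
lemma velocity_past: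
  assumes ae: "AE \<omega> in M. mono_on {0..} (\<lambda>t. N t \<omega>) \<and> (\<forall>t\<ge>0. D t \<omega> = \<xi> (N t \<omega>) \<omega>)"
    and s: "0 \<le> s" and A: "A \<in> generated_sigma M {u \<in> {0..}. u \<le> s} (velocity_z D)"
  shows "\<exists>A'\<in>sigma_sets (space M) (past_events M \<xi> N n s).
    AE \<omega> in M. N s \<omega> = n \<longrightarrow> (\<omega> \<in> A \<longleftrightarrow> \<omega> \<in> A')"
  using A unfolding generated_sigma_def
proof (induction A rule: sigma_sets.induct)
  case (Basic A)
  then obtain u B where u: "0 \<le> u" "u \<le> s" and A: "A = velocity_z D u -` B \<inter> space M"
    by auto
  \<comment> \<open>The random index is resolved by the value \<open>k\<close> of
    \<open>min (N u) n\<close>, so each piece reads the history at a fixed index not exceeding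
    \<open>n\<close>.\<close>
  define A' where "A' k = {\<omega> \<in> space M. restrict (\<lambda>k. \<xi> k \<omega>) {..n} \<in> {y. indicator z_directions (y (min k n)) \<in> B} \<and>
    restrict (\<lambda>u. N u \<omega>) {u} \<in> {y. min (y u) n = k}}" for k
  have "A' k \<in> past_events M \<xi> N n s" for k
    unfolding past_events_def A'_def using u by (intro CollectI exI conjI) (rule refl, auto)
  then have "(\<Union>k. A' k) \<in> sigma_sets (space M) (past_events M \<xi> N n s)"
    by (intro sigma_sets.Union sigma_sets.Basic)
  moreover have "AE \<omega> in M. N s \<omega> = n \<longrightarrow> (\<omega> \<in> A \<longleftrightarrow> \<omega> \<in> (\<Union>k. A' k))"
    using ae
  proof eventually_elim
    case (elim \<omega>)
    then have "N u \<omega> \<le> N s \<omega>" using u s by (auto simp: mono_on_def)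
    moreover have "D u \<omega> = \<xi> (N u \<omega>) \<omega>" using elim u by auto
    ultimately show ?case
      unfolding A A'_def velocity_z_def by auto
  qed
  ultimately show ?case by (rule bexI[rotated])
next
  case Empty
  show ?case by (rule bexI[OF _ sigma_sets.Empty]) simp
next
  case (Compl A)
  from Compl.IH obtain A' where "A' \<in> sigma_sets (space M) (past_events M \<xi> N n s)"
    and A': "AE \<omega> in M. N s \<omega> = n \<longrightarrow> (\<omega> \<in> A \<longleftrightarrow> \<omega> \<in> A')" by (rule bexE)
  then have "space M - A' \<in> sigma_sets (space M) (past_events M \<xi> N n s)"
    by (intro sigma_sets.Compl)
  moreover have "AE \<omega> in M. N s \<omega> = n \<longrightarrow> (\<omega> \<in> space M - A \<longleftrightarrow> \<omega> \<in> space M - A')"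
    using A' by eventually_elim auto
  ultimately show ?case by (rule bexI[rotated])
next
  case (Union A)
  then have "\<forall>k. \<exists>A'. A' \<in> sigma_sets (space M) (past_events M \<xi> N n s) \<and>
      (AE \<omega> in M. N s \<omega> = n \<longrightarrow> (\<omega> \<in> A k \<longleftrightarrow> \<omega> \<in> A'))" by (simp add: Bex_def)
  from choice[OF this] obtain A' where
    A': "\<forall>k. A' k \<in> sigma_sets (space M) (past_events M \<xi> N n s) \<and>
      (AE \<omega> in M. N s \<omega> = n \<longrightarrow> (\<omega> \<in> A k \<longleftrightarrow> \<omega> \<in> A' k))" ..
  then have "(\<Union>k. A' k) \<in> sigma_sets (space M) (past_events M \<xi> N n s)"
    by (intro sigma_sets.Union) simp
  moreover have "AE \<omega> in M. \<forall>k. N s \<omega> = n \<longrightarrow> (\<omega> \<in> A k \<longleftrightarrow> \<omega> \<in> A' k)"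
    unfolding AE_all_countable using A' by simp
  then have "AE \<omega> in M. N s \<omega> = n \<longrightarrow> (\<omega> \<in> (\<Union>k. A k) \<longleftrightarrow> \<omega> \<in> (\<Union>k. A' k))"
    by eventually_elim auto
  ultimately show ?case by (rule bexI[rotated])
qed

section \<open>Markov property and paths of the velocity for finite cumulative rate\<close>

lemma velocity_z_pred:
  assumes "D t \<in> M \<rightarrow>\<^sub>M count_space directions"
  shows "Measurable.pred M (\<lambda>\<omega>. velocity_z D t \<omega> = v)"
  by (rule measurable_compose[OF velocity_z_measurable[of D t M, OF assms]]) simp

text \<open>Given \<open>N s = n\<close> and \<open>N t - N s = m\<close>, the directions at
  \<open>s\<close> and \<open>t\<close> are \<open>\<xi> n\<close> and \<open>\<xi> (n + m)\<close>.
  The resulting weight \<open>w m\<close> does not depend on \<open>n\<close>, so the sum over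
  \<open>m\<close> gives the factor \<open>Q\<close>, which then comes out of the sum over
  \<open>n\<close>.\<close>

lemma poisson_direction_markov:
  assumes N: "poisson_process M l N" and \<xi>: "direction_chain M \<kappa> \<xi>"
    and ind: "prob_space.indep_set M (generated_sigma M UNIV \<xi>) (generated_sigma M {0..} N)"
    and D_meas: "\<And>t. 0 \<le> t \<Longrightarrow> D t \<in> M \<rightarrow>\<^sub>M count_space directions"
    and D: "AE \<omega> in M. \<forall>t\<ge>0. D t \<omega> = \<xi> (N t \<omega>) \<omega>"
    and st: "0 \<le> s" "s < t" and pos: "0 < (LBINT u:{s<..t}. l u)"
    and A: "A \<in> generated_sigma M {u \<in> {0..}. u \<le> s} (velocity_z D)" and j: "j \<in> {0, 1}"
  shows "\<P>(\<omega> in M. \<omega> \<in> A \<and> velocity_z D s \<omega> = i \<and> velocity_z D t \<omega> = j) =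
    \<P>(\<omega> in M. \<omega> \<in> A \<and> velocity_z D s \<omega> = i) *
    two_state_kernel (exp (- (1 - switch_eigenvalue \<kappa>) * (LBINT u:{s<..t}. l u))) i j"
proof -
  have M: "prob_space M" using N by (simp add: poisson_process_def)
  interpret prob_space M by fact
  let ?V = "velocity_z D"
  have "AE \<omega> in M. mono_on {0..} (\<lambda>t. N t \<omega>)"
    using N by (auto simp: poisson_process_def)
  with D have ae: "AE \<omega> in M. mono_on {0..} (\<lambda>t. N t \<omega>) \<and> (\<forall>t\<ge>0. D t \<omega> = \<xi> (N t \<omega>) \<omega>)"
    by eventually_elim auto
  define w where "w m = pmf (poisson_pmf (LBINT u:{s<..t}. l u)) m * two_state_kernel (switch_eigenvalue \<kappa> ^ m) i j" for m
  define Q where "Q = two_state_kernel (exp (- (1 - switch_eigenvalue \<kappa>) * (LBINT u:{s<..t}. l u))) i j"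
  have w: "w sums Q"
    unfolding w_def[abs_def] Q_def by (rule poisson_kernel_sums[OF pos])
  have N_meas: "N u \<in> M \<rightarrow>\<^sub>M count_space UNIV" if "0 \<le> u" for u
    using N that by (simp add: poisson_process_def)
  have N_pred: "Measurable.pred M (\<lambda>\<omega>. N s \<omega> = n)" for n
    by (rule measurable_compose[OF N_meas[OF st(1)]]) simp
  have N_pred': "Measurable.pred M (\<lambda>\<omega>. N t \<omega> - N s \<omega> = m)" for m
  proof -
    have "{\<omega> \<in> space M. restrict (\<lambda>u. N u \<omega>) {s, t} \<in> {y. y t - y s = m}} \<in> events"
      by (rule restrict_event[where S = UNIV]) (use N_meas st in auto)
    then show ?thesis by (simp add: pred_def)
  qed
  have V_pred: "Measurable.pred M (\<lambda>\<omega>. ?V u \<omega> = v)" if "0 \<le> u" for u v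
    by (rule velocity_z_pred) (rule D_meas[OF that])
  note [measurable] = V_pred[OF st(1)] V_pred[OF order.trans[OF st(1) less_imp_le[OF st(2)]]]
    direction_chain_pred[OF \<xi>] N_pred N_pred'
  have [measurable]: "A \<in> sets M"
  proof -
    have "generated_sigma M {u \<in> {0..}. u \<le> s} ?V \<subseteq> sets M"
    proof (rule generated_sigma_sets[where S = "{0, 1}"])
      fix u assume "u \<in> {u \<in> {0..}. u \<le> s}"
      then show "?V u \<in> M \<rightarrow>\<^sub>M count_space {0, 1}"
        by (intro velocity_z_measurable[of D u M] D_meas) simp
    qed
    then show ?thesis using A by auto
  qed
  have joint: "\<P>(\<omega> in M. (\<omega> \<in> A \<and> ?V s \<omega> = i \<and> ?V t \<omega> = j \<and> N s \<omega> = n) \<and> N t \<omega> - N s \<omega> = m) =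
      w m * \<P>(\<omega> in M. (\<omega> \<in> A \<and> ?V s \<omega> = i) \<and> N s \<omega> = n)" for n m
  proof -
    obtain A' where A': "A' \<in> sigma_sets (space M) (past_events M \<xi> N n s)"
      and eq: "AE \<omega> in M. N s \<omega> = n \<longrightarrow> (\<omega> \<in> A \<longleftrightarrow> \<omega> \<in> A')"
      using velocity_past[OF ae st(1) A] by blast
    let ?G = "{\<omega> \<in> space M. N s \<omega> = n \<and> N t \<omega> - N s \<omega> = m \<and>
      indicator z_directions (\<xi> n \<omega>) = i \<and> indicator z_directions (\<xi> (n + m) \<omega>) = j}"
    let ?G' = "{\<omega> \<in> space M. N s \<omega> = n \<and> indicator z_directions (\<xi> n \<omega>) = i}"
    have G [measurable]: "?G \<in> events" "?G' \<in> events"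
      by measurable
    have past: "past_events M \<xi> N n s \<subseteq> events"
      by (rule past_events_generated[OF ind M \<xi>])
    then have [measurable]: "A' \<in> events"
      using A' sets.sigma_sets_subset by blast
    have "space M = {\<omega> \<in> space M. restrict (\<lambda>k. \<xi> k \<omega>) {..n} \<in> UNIV \<and> restrict (\<lambda>u. N u \<omega>) {} \<in> UNIV}"
      by simp
    then have top: "space M \<in> past_events M \<xi> N n s"
      unfolding past_events_def by blast
    \<comment> \<open>With fixed indices, the identity for rectangles extends to the sigma-algebra
      that they generate.\<close>
    have "prob (A' \<inter> ?G) = w m * prob (A' \<inter> ?G')"
    proof (rule prob_ratio_sigma_sets[OF Int_stable_past_events past top G _ A'])
      fix A assume "A \<in> past_events M \<xi> N n s"
      then show "prob (A \<inter> ?G) = w m * prob (A \<inter> ?G')"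
        unfolding w_def by (rule past_events_markov[OF N \<xi> ind st j])
    qed
    moreover have "\<P>(\<omega> in M. (\<omega> \<in> A \<and> ?V s \<omega> = i \<and> ?V t \<omega> = j \<and> N s \<omega> = n) \<and> N t \<omega> - N s \<omega> = m) = prob (A' \<inter> ?G)"
    proof (rule finite_measure_eq_AE)
      show "AE \<omega> in M. \<omega> \<in> {\<omega> \<in> space M. (\<omega> \<in> A \<and> ?V s \<omega> = i \<and> ?V t \<omega> = j \<and> N s \<omega> = n) \<and> N t \<omega> - N s \<omega> = m} \<longleftrightarrow>
          \<omega> \<in> A' \<inter> ?G"
        using eq ae
      proof eventually_elim
        case (elim \<omega>)
        \<comment> \<open>Monotonicity turns the truncated difference into a true one.\<close>
        have "N s \<omega> \<le> N t \<omega>" using elim st by (auto simp: mono_on_def)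
        then have "N t \<omega> = n + m" if "N s \<omega> = n" "N t \<omega> - N s \<omega> = m" using that by simp
        moreover have "?V s \<omega> = indicator z_directions (\<xi> (N s \<omega>) \<omega>)" "?V t \<omega> = indicator z_directions (\<xi> (N t \<omega>) \<omega>)"
          using elim st by (auto simp: velocity_z_def)
        ultimately show ?case using elim(1) by auto
      qed
    qed measurable
    moreover have "\<P>(\<omega> in M. (\<omega> \<in> A \<and> ?V s \<omega> = i) \<and> N s \<omega> = n) = prob (A' \<inter> ?G')"
    proof (rule finite_measure_eq_AE)
      show "AE \<omega> in M. \<omega> \<in> {\<omega> \<in> space M. (\<omega> \<in> A \<and> ?V s \<omega> = i) \<and> N s \<omega> = n} \<longleftrightarrow> \<omega> \<in> A' \<inter> ?G'"
        using eq ae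
      proof eventually_elim
        case (elim \<omega>)
        have "?V s \<omega> = indicator z_directions (\<xi> (N s \<omega>) \<omega>)"
          using elim st by (auto simp: velocity_z_def)
        then show ?case using elim(1) by auto
      qed
    qed measurable
    ultimately show ?thesis by simp
  qed
  have step: "\<P>(\<omega> in M. (\<omega> \<in> A \<and> ?V s \<omega> = i \<and> ?V t \<omega> = j) \<and> N s \<omega> = n) =
      Q * \<P>(\<omega> in M. (\<omega> \<in> A \<and> ?V s \<omega> = i) \<and> N s \<omega> = n)" for n
  proof -
    let ?q = "\<P>(\<omega> in M. (\<omega> \<in> A \<and> ?V s \<omega> = i) \<and> N s \<omega> = n)"
    have *: "(\<lambda>m. w m * ?q) sums \<P>(\<omega> in M. \<omega> \<in> A \<and> ?V s \<omega> = i \<and> ?V t \<omega> = j \<and> N s \<omega> = n)"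
      unfolding joint[symmetric] by (rule measure_sums_nat) measurable
    show ?thesis
      using sums_unique2[OF * sums_mult2[OF w]] by (simp only: conj_assoc)
  qed
  have "(\<lambda>n. Q * \<P>(\<omega> in M. (\<omega> \<in> A \<and> ?V s \<omega> = i) \<and> N s \<omega> = n)) sums
      \<P>(\<omega> in M. \<omega> \<in> A \<and> ?V s \<omega> = i \<and> ?V t \<omega> = j)"
    unfolding step[symmetric] by (rule measure_sums_nat) measurable
  moreover have "(\<lambda>n. Q * \<P>(\<omega> in M. (\<omega> \<in> A \<and> ?V s \<omega> = i) \<and> N s \<omega> = n)) sums
      (Q * \<P>(\<omega> in M. \<omega> \<in> A \<and> ?V s \<omega> = i))"
    by (intro sums_mult measure_sums_nat) measurable
  ultimately have "\<P>(\<omega> in M. \<omega> \<in> A \<and> ?V s \<omega> = i \<and> ?V t \<omega> = j) = Q * \<P>(\<omega> in M. \<omega> \<in> A \<and> ?V s \<omega> = i)"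
    by (rule sums_unique2)
  also have "\<dots> = \<P>(\<omega> in M. \<omega> \<in> A \<and> ?V s \<omega> = i) * Q"
    by (rule mult.commute)
  finally show ?thesis
    unfolding Q_def .
qed

text \<open>Right-constancy comes from \<open>N\<close>. For the left limit at \<open>t > 0\<close>,
  \<open>N\<close> is monotone and bounded by \<open>N t\<close> on \<open>{0..<t}\<close>, so it
  attains its maximum there and is constant from then on.\<close>

lemma poisson_direction_jump_path:
  assumes N: "poisson_process M l N" and D: "AE \<omega> in M. \<forall>t\<ge>0. D t \<omega> = \<xi> (N t \<omega>) \<omega>"
  shows "AE \<omega> in M. jump_path {0..} (\<lambda>t. velocity_z D t \<omega>)"
proof -
  have "AE \<omega> in M. mono_on {0..} (\<lambda>t. N t \<omega>) \<and> (\<forall>t\<ge>0. \<forall>\<^sub>F s in at_right t. N s \<omega> = N t \<omega>)"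
    using N by (auto simp: poisson_process_def)
  with D show ?thesis
  proof eventually_elim
    case (elim \<omega>)
    have V: "velocity_z D t \<omega> = indicator z_directions (\<xi> (N t \<omega>) \<omega>)" if "0 \<le> t" for t
      using elim that by (simp add: velocity_z_def)
    show ?case
      unfolding jump_path_def
    proof (intro ballI conjI)
      fix t :: real assume t: "t \<in> {0..}"
      have "\<forall>\<^sub>F s in at_right t. N s \<omega> = N t \<omega>" "\<forall>\<^sub>F s in at_right t. t < s"
        using elim t by (auto simp: eventually_at_right_less)
      then show "\<forall>\<^sub>F s in at_right t. velocity_z D s \<omega> = velocity_z D t \<omega>"
        by eventually_elim (use t in \<open>auto simp: V\<close>)
      show "\<exists>y. \<forall>\<^sub>F s in at t within {0..} \<inter> {..<t}. velocity_z D s \<omega> = y"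
      proof (cases "t = 0")
        case True
        then have "{0..} \<inter> {..<t} = {}" by auto
        then show ?thesis by simp
      next
        case False
        have mono: "N u \<omega> \<le> N v \<omega>" if "0 \<le> u" "u \<le> v" for u v
          using elim that by (auto simp: mono_on_def)
        define n where "n = Max ((\<lambda>s. N s \<omega>) ` {0..<t})"
        have fin: "finite ((\<lambda>s. N s \<omega>) ` {0..<t})"
          by (rule finite_subset[of _ "{..N t \<omega>}"]) (auto intro: mono)
        have "n \<in> (\<lambda>s. N s \<omega>) ` {0..<t}"
          unfolding n_def using t False by (intro Max_in fin) auto
        then obtain u where u: "0 \<le> u" "u < t" "n = N u \<omega>" by auto
        have const: "N s \<omega> = n" if "u \<le> s" "s < t" for s
        proof (rule antisym)
          show "N s \<omega> \<le> n"
            unfolding n_def by (rule Max_ge[OF fin]) (use that u in auto)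
          show "n \<le> N s \<omega>"
            unfolding u(3) by (rule mono) (use that u in auto)
        qed
        have "velocity_z D s \<omega> = indicator z_directions (\<xi> n \<omega>)" if "u \<le> s" "s < t" for s
          using const[OF that] V[of s] u(1) that(1) by simp
        then have "\<forall>\<^sub>F s in at t within {0..} \<inter> {..<t}. velocity_z D s \<omega> = indicator z_directions (\<xi> n \<omega>)"
          unfolding eventually_at using u(1,2) by (intro exI[of _ "t - u"]) (auto simp: dist_real_def)
        then show ?thesis by blast
      qed
    qed
  qed
qed

section \<open>Joining the two cases\<close>

lemma jump_path_image:
  assumes "jump_path I x"
  shows "jump_path I (\<lambda>t. f (x t))"
  unfolding jump_path_def
proof (intro ballI conjI)
  fix t assume t: "t \<in> I"
  then have "\<forall>\<^sub>F s in at_right t. x s = x t"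
    using assms by (simp add: jump_path_def)
  then show "\<forall>\<^sub>F s in at_right t. f (x s) = f (x t)"
    by eventually_elim simp
  obtain y where "\<forall>\<^sub>F s in at t within (I \<inter> {..<t}). x s = y"
    using assms t by (auto simp: jump_path_def)
  then have "\<forall>\<^sub>F s in at t within (I \<inter> {..<t}). f (x s) = f y"
    by eventually_elim simp
  then show "\<exists>z. \<forall>\<^sub>F s in at t within (I \<inter> {..<t}). f (x s) = z" ..
qed

text \<open>For finite rate the uniform law is known at time 0 and has to be propagated by the
  kernel; otherwise it is part of the specification at every positive time.\<close>

lemma direction_process_velocity:
  assumes l: "continuous_on {0<..} l" "\<And>t. t > 0 \<Longrightarrow> l t > 0"
    and D: "direction_process M \<kappa> l D"
  defines "b \<equiv> 1 - switch_eigenvalue \<kappa>"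
  shows "one_dim_motion M (time_parallel_z D) (velocity_z D) (\<lambda>t. 2 * b / 3 * l t) (\<lambda>t. b / 3 * l t)"
    and "\<And>t. 0 \<le> t \<Longrightarrow> \<P>(\<omega> in M. velocity_z D t \<omega> = 1) = 1/3"
proof -
  have M: "prob_space M" and D_meas: "\<And>t. 0 \<le> t \<Longrightarrow> D t \<in> M \<rightarrow>\<^sub>M count_space directions"
    and D0: "uniform_direction M (D 0)"
    using D by (auto simp: direction_process_def)
  interpret prob_space M by fact
  have b: "0 < b" using switch_eigenvalue_less_1[of \<kappa>] by (simp add: b_def)
  have both: "one_dim_motion M (time_parallel_z D) (velocity_z D) (\<lambda>t. 2 * b / 3 * l t) (\<lambda>t. b / 3 * l t) \<and>
    (\<forall>t\<ge>0. \<P>(\<omega> in M. velocity_z D t \<omega> = 1) = 1/3)"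
  proof (cases "finite_rate l")
    case True
    then obtain N \<xi> where N: "poisson_process M l N" and \<xi>: "direction_chain M \<kappa> \<xi>"
      and ind: "indep_set (generated_sigma M UNIV \<xi>) (generated_sigma M {0..} N)"
      and DN: "AE \<omega> in M. \<forall>t\<ge>0. D t \<omega> = \<xi> (N t \<omega>) \<omega>"
      using D by (auto simp: direction_process_def)
    define H where "H t = (LBINT u:{0<..t}. l u)" for t
    note H = cumulative_rate_primitive[OF l True, folded H_def]
    have pos: "0 < (LBINT u:{s<..t}. l u)" if "0 \<le> s" "s < t" for s t
    proof -
      have "H s < H t"
      proof (rule DERIV_pos_imp_increasing_open[OF that(2)])
        show "\<exists>y. (H has_real_derivative y) (at x) \<and> 0 < y" if "s < x" "x < t" for x
          using H(3)[of x] l(2)[of x] that \<open>0 \<le> s\<close> by (intro exI[of _ "l x"]) auto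
        show "continuous_on {s..t} H"
          using H(2) by (rule continuous_on_subset) (use that in auto)
      qed
      then show ?thesis using H(1)[of s t] that by simp
    qed
    have markov: "\<P>(\<omega> in M. \<omega> \<in> A \<and> velocity_z D s \<omega> = i \<and> velocity_z D t \<omega> = j) =
        \<P>(\<omega> in M. \<omega> \<in> A \<and> velocity_z D s \<omega> = i) * two_state_kernel (exp (- b * (H t - H s))) i j"
      if "s \<in> {0..}" "t \<in> {0..}" "s \<le> t" "A \<in> generated_sigma M {u \<in> {0..}. u \<le> s} (velocity_z D)"
        "i \<in> {0, 1}" "j \<in> {0, 1}" for s t A i j
    proof (cases "s = t")
      \<comment> \<open>\<open>poisson_direction_markov\<close> needs a positive cumulative rate, so
        the empty interval is treated directly: the kernel with factor 1 is the identity.\<close>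
      case True
      have "{\<omega> \<in> space M. \<omega> \<in> A \<and> velocity_z D t \<omega> = i \<and> velocity_z D t \<omega> = j} =
          (if i = j then {\<omega> \<in> space M. \<omega> \<in> A \<and> velocity_z D t \<omega> = i} else {})" by auto
      moreover have "two_state_kernel 1 i j = (if i = j then 1 else 0)"
        using that(5,6) by (auto simp: two_state_kernel_def)
      ultimately show ?thesis
        using True by simp
    next
      case False
      with that have st: "0 \<le> s" "s < t" by auto
      show ?thesis
        using poisson_direction_markov[OF N \<xi> ind D_meas DN st pos[OF st] that(4,6)] H(1)[of s t] st
        by (simp add: b_def)
    qed
    have "\<P>(\<omega> in M. velocity_z D t \<omega> = 1) = 1/3" if t: "0 \<le> t" for t
    proof -
      \<comment> \<open>Conditioning on time 0 with the trivial past event. The initial law is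
        stationary: \<open>1/3 * (1/3 + 2/3 * \<rho>) + 2/3 * (1/3 - 1/3 * \<rho>) =
        1/3\<close>.\<close>
      have "space M \<in> generated_sigma M {u \<in> {0..}. u \<le> 0} (velocity_z D)"
        unfolding generated_sigma_def by (rule sigma_sets_top)
      then have *: "\<P>(\<omega> in M. velocity_z D t \<omega> = 1 \<and> velocity_z D 0 \<omega> = i) =
          \<P>(\<omega> in M. velocity_z D 0 \<omega> = i) * two_state_kernel (exp (- b * (H t - H 0))) i 1"
        if "i \<in> {0, 1}" for i
        using markov[of 0 t "space M" i 1] that t by (simp add: conj_commute cong: conj_cong)
      have V_pred: "Measurable.pred M (\<lambda>\<omega>. velocity_z D u \<omega> = v)" if "0 \<le> u" for u v
        by (rule velocity_z_pred) (rule D_meas[OF that])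
      note [measurable] = V_pred[OF order.refl] V_pred[OF t]
      have "\<P>(\<omega> in M. velocity_z D t \<omega> = 1) = \<P>(\<omega> in M. velocity_z D t \<omega> = 1 \<and> velocity_z D 0 \<omega> \<in> {0, 1})"
        by (simp add: velocity_z_def indicator_def)
      also have "\<dots> = (\<Sum>i\<in>{0, 1}. \<P>(\<omega> in M. velocity_z D t \<omega> = 1 \<and> velocity_z D 0 \<omega> = i))"
        by (rule measure_sum_values) auto
      also have "\<dots> = 1/3"
        using uniform_direction_velocity_z[of M D 0, OF D0] by (simp add: * two_state_kernel_def field_simps)
      finally show ?thesis .
    qed
    moreover have "one_dim_motion M (time_parallel_z D) (velocity_z D) (\<lambda>t. 2 * b / 3 * l t) (\<lambda>t. b / 3 * l t)"
      by (rule velocity_z_one_dim_motion[OF M D_meas l(2,1) _ _ H(2,3) b markov])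
        (simp_all add: True poisson_direction_jump_path[OF N DN])
    ultimately show ?thesis by blast
  next
    case False
    then have DM: "markov_jump_process M {0<..} directions (\<lambda>t d e. l t * pmf (next_direction \<kappa> d) e) D"
      and unif: "\<And>t. t > 0 \<Longrightarrow> uniform_direction M (D t)"
      using D by (auto simp: direction_process_def)
    obtain H where H: "\<And>t. t > 0 \<Longrightarrow> (H has_real_derivative l t) (at t)"
      using primitive_on_positive_reals[OF l(1)] by blast
    have "AE \<omega> in M. jump_path {0<..} (\<lambda>t. D t \<omega>)"
      using DM by (simp add: markov_jump_process_def)
    then have path: "AE \<omega> in M. jump_path {0<..} (\<lambda>t. velocity_z D t \<omega>)"
      unfolding velocity_z_def by eventually_elim (rule jump_path_image[where f = "indicator z_directions"])
    have cont: "continuous_on {0<..} H"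
      by (intro DERIV_continuous_on[of _ _ l]) (auto intro!: has_field_derivative_at_within H)
    have "one_dim_motion M (time_parallel_z D) (velocity_z D) (\<lambda>t. 2 * b / 3 * l t) (\<lambda>t. b / 3 * l t)"
    proof (rule velocity_z_one_dim_motion[OF M D_meas l(2,1) _ path cont H b])
      fix s t i j :: real and A
      assume "s \<in> {0<..}" "t \<in> {0<..}" "s \<le> t" "A \<in> generated_sigma M {u \<in> {0<..}. u \<le> s} (velocity_z D)"
        "i \<in> {0, 1}" "j \<in> {0, 1}"
      then show "\<P>(\<omega> in M. \<omega> \<in> A \<and> velocity_z D s \<omega> = i \<and> velocity_z D t \<omega> = j) =
          \<P>(\<omega> in M. \<omega> \<in> A \<and> velocity_z D s \<omega> = i) * two_state_kernel (exp (- b * (H t - H s))) i j"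
        using markov_direction_velocity[OF DM H, of s t A i j] by (simp add: b_def)
    qed (use False in auto)
    moreover have "\<P>(\<omega> in M. velocity_z D t \<omega> = 1) = 1/3" if "0 \<le> t" for t
    proof -
      have "uniform_direction M (D t)" using that D0 unif[of t] by (cases "t = 0") auto
      then show ?thesis by (rule uniform_direction_velocity_z(1))
    qed
    ultimately show ?thesis by blast
  qed
  show "one_dim_motion M (time_parallel_z D) (velocity_z D) (\<lambda>t. 2 * b / 3 * l t) (\<lambda>t. b / 3 * l t)"
    using both by (rule conjunct1)
  show "\<P>(\<omega> in M. velocity_z D t \<omega> = 1) = 1/3" if "0 \<le> t" for t
    using both that by blast
qed

theorem theorem4p1:
  fixes M :: "'w measure" and \<kappa> :: motion_kind and c :: real and l :: "real \<Rightarrow> real"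
    and D W :: "real \<Rightarrow> 'w \<Rightarrow> real ^ 3"
  assumes "c > 0"
    and "\<forall>t>0. l t > 0"
    and "l C1_differentiable_on {0<..}"
    and "orthogonal_random_motion M \<kappa> c l D W"
  shows "\<exists>l1 l0.
      one_dim_motion M (time_parallel_z D) (velocity_z D) l1 l0 \<and>
      (\<forall>t>0. l1 t \<noteq> l0 t) \<and>
      initial_prob M (velocity_z D) 1 (1/3) \<and>
      initial_prob M (velocity_z D) 0 (2/3) \<and>
      (\<kappa> = OSM \<longrightarrow> (\<forall>t>0. l1 t = l t \<and> l0 t = l t / 2)) \<and>
      (\<kappa> = OUM \<longrightarrow> (\<forall>t>0. l1 t = 2 * l t / 3 \<and> l0 t = l t / 3))"
proof -
  let ?b = "1 - switch_eigenvalue \<kappa>"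
  have l: "continuous_on {0<..} l" "\<And>t. t > 0 \<Longrightarrow> l t > 0"
    using assms(2,3) by (auto intro: C1_differentiable_imp_continuous_on)
  have D: "direction_process M \<kappa> l D"
    using assms(4) by (simp add: orthogonal_random_motion_def)
  interpret prob_space M
    using D by (simp add: direction_process_def)
  have one: "\<P>(\<omega> in M. velocity_z D t \<omega> = 1) = 1/3" if "0 \<le> t" for t
    by (rule direction_process_velocity(2)[OF l D that])
  have zero: "\<P>(\<omega> in M. velocity_z D t \<omega> = 0) = 2/3" if "0 \<le> t" for t
  proof -
    have "D t \<in> M \<rightarrow>\<^sub>M count_space directions"
      using D that by (simp add: direction_process_def)
    from velocity_z_pred[of D t M, OF this, of 1]
    have "{\<omega> \<in> space M. velocity_z D t \<omega> = 1} \<in> events" by simp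
    then have "\<P>(\<omega> in M. \<not> velocity_z D t \<omega> = 1) = 1 - 1/3"
      using one[OF that] by (subst prob_neg) auto
    moreover have "\<not> velocity_z D t \<omega> = 1 \<longleftrightarrow> velocity_z D t \<omega> = 0" for \<omega>
      by (simp add: velocity_z_def indicator_def)
    ultimately show ?thesis by simp
  qed
  \<comment> \<open>The one-time probabilities are constant in time, so the limit at
    \<open>0+\<close> is that of a constant.\<close>
  have limit: "(f \<longlongrightarrow> p) (at_right 0)" if "\<And>t. 0 \<le> t \<Longrightarrow> f t = p" for f :: "real \<Rightarrow> real" and p
    by (rule tendsto_eventually) (use that in \<open>auto intro!: eventually_at_rightI[of 0 1]\<close>)
  have "initial_prob M (velocity_z D) 1 (1/3)" "initial_prob M (velocity_z D) 0 (2/3)"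
    unfolding initial_prob_def by (intro conjI one zero limit order.refl; assumption)+
  moreover have "2 * ?b / 3 * l t \<noteq> ?b / 3 * l t" if "t > 0" for t
    using l(2)[OF that] switch_eigenvalue_less_1[of \<kappa>] by simp
  \<comment> \<open>\<open>1 - switch_eigenvalue \<kappa>\<close> is \<open>3/2\<close> for OSM and
    1 for OUM; two thirds and one third of it are the required factors.\<close>
  moreover have "\<kappa> = OSM \<longrightarrow> (\<forall>t>0. 2 * ?b / 3 * l t = l t \<and> ?b / 3 * l t = l t / 2)"
    "\<kappa> = OUM \<longrightarrow> (\<forall>t>0. 2 * ?b / 3 * l t = 2 * l t / 3 \<and> ?b / 3 * l t = l t / 3)"
    by auto
  ultimately show ?thesis
    using direction_process_velocity(1)[OF l D] by blast
qed

end
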